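(* Let $n\ge k\ge 0$ be integers and let $N\ge 0$ be an integer. The number of truncated lecture hall partitions of $N$ in $L_{n,k}$ (i.e. elements $\lambda\in L_{n,k}$ with $|\lambda|=N$) is equal to the number of partitions of $N$ into odd parts less than $2n$ with the following constraint: at most $\lfloor k/2\rfloor$ parts (counted with multiplicity) can be chosen from the set $$\{2\lceil k/2\rceil+1,\ 2\lceil k/2\rceil+3,\ \ldots,\ 2(n-\lfloor k/2\rfloor)-1\}.$$
   Context: For $n\ge k$, $L_{n,k}$ is the set of truncated lecture hall partitions: sequences $\lambda=(\lambda_1,\ldots,\lambda_k)$ of nonnegative integers with $$\frac{\lambda_1}{n}\ge\frac{\lambda_2}{n-1}\ge\cdots\ge\frac{\lambda_k}{n-k+1}\ge 0$$ (for $k=0$ the set consists of the empty sequence only), and $|\lambda|=\lambda_1+\cdots+\lambda_k$. The displayed set is the set of odd integers $j$ with $2\lceil k/2\rceil+1\le j\le 2(n-\lfloor k/2\rfloor)-1$ (empty when $n=k$). *)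

theory Defs
  imports Complex_Main "HOL-Library.Multiset"
begin

text \<open>
  A sequence is a list with \<open>xs ! i\<close> standing for \<open>\<lambda>\<^sub>i\<^sub>+\<^sub>1\<close>, so its denominator is \<open>n - i\<close>.
  For \<open>k \<le> n\<close> all denominators are positive and the natural-number subtractions do not truncate.
  The final inequality \<open>\<dots> \<ge> 0\<close> holds because the entries are natural numbers.
\<close>

definition truncated_lecture_hall :: "nat \<Rightarrow> nat \<Rightarrow> nat list set" where
  "truncated_lecture_hall n k =
     {xs. length xs = k \<and>
          (\<forall>i. Suc i < k \<longrightarrow>
             real (xs ! i) / real (n - i) \<ge> real (xs ! Suc i) / real (n - Suc i))}"

definition partitions_of :: "nat \<Rightarrow> nat multiset set" where
  "partitions_of N = {p. 0 \<notin># p \<and> sum_mset p = N}"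

text \<open>\<open>(k + 1) div 2\<close> is \<open>\<lceil>k/2\<rceil>\<close>.\<close>

definition restricted_parts :: "nat \<Rightarrow> nat \<Rightarrow> nat set" where
  "restricted_parts n k =
     {j. odd j \<and> 2 * ((k + 1) div 2) + 1 \<le> j \<and> j \<le> 2 * (n - k div 2) - 1}"

end

theory Submission
  imports Defs "HOL-Computational_Algebra.Formal_Laurent_Series"
begin

text \<open>
  Let \<open>A\<^sub>k\<close> be the generating function of the truncated lecture hall partitions of length \<open>k\<close> with
  positive parts. In such a partition the entries with \<open>\<lceil>\<lambda>\<^sub>i / (n - i + 1)\<rceil> \<ge> 2\<close> form an initial segment.
  Subtracting \<open>n - i + 1\<close> from each of them leaves a shorter partition of the same kind, and the remaining
  entries form an arbitrary strictly decreasing sequence bounded by \<open>n - m\<close>, where \<open>m\<close> is the length of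
  the segment. This expresses \<open>A\<^sub>k\<close> through \<open>A\<^sub>0, \<dots>, A\<^sub>k\<close>, and by the q-Chu-Vandermonde identity the solution is
  a product with \<open>(1 - q^k) (1 - q^(2n-k+1)) A\<^sub>k = q^k (1 - q^(2(n-k+1))) A\<^sub>k\<^sub>-\<^sub>1\<close>.
  The generating function of the odd partitions is a sum of complete homogeneous polynomials in consecutive
  odd powers of \<open>q\<close>, divided by a product. Its increment from \<open>k - 1\<close> to \<open>k\<close> collapses to a single
  Gaussian binomial over a product, which satisfies the same first-order recurrence. Hence both sides
  equal \<open>A\<^sub>0 + \<dots> + A\<^sub>k\<close>.
\<close>

section \<open>Gaussian binomials and the q-Chu-Vandermonde identity\<close>

definition qfact :: "'a::comm_ring_1 \<Rightarrow> nat \<Rightarrow> 'a" where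
  "qfact q n = (\<Prod>i<n. 1 - q ^ Suc i)"

text \<open>The Gaussian binomial, given by a Pascal rule instead of a quotient so that it exists
  over every commutative ring. For \<open>n < k\<close> the truncated exponent \<open>n - k\<close>
  is harmless, as it multiplies \<open>qbin q n k = 0\<close>.\<close>

fun qbin :: "'a::comm_ring_1 \<Rightarrow> nat \<Rightarrow> nat \<Rightarrow> 'a" where
  "qbin q n 0 = 1"
| "qbin q 0 (Suc k) = 0"
| "qbin q (Suc n) (Suc k) = qbin q n (Suc k) + q ^ (n - k) * qbin q n k"

lemma qbin_eq_0: "n < k \<Longrightarrow> qbin q n k = 0"
  by (induction q n k rule: qbin.induct) auto

lemma qfact_0 [simp]: "qfact q 0 = 1"
  by (simp add: qfact_def)

lemma qfact_Suc [simp]: "qfact q (Suc n) = qfact q n * (1 - q ^ Suc n)"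
  by (simp add: qfact_def)

text \<open>In the induction on \<open>k + d\<close> the two Pascal summands contribute
  \<open>1 - q ^ d\<close> and \<open>q ^ d * (1 - q ^ k)\<close>, which add up to
  \<open>1 - q ^ (k + d)\<close>.\<close>

lemma qbin_qfact_add: "qbin q (k + d) k * qfact q k * qfact q d = qfact q (k + d)"
proof (induction "k + d" arbitrary: k d)
  case 0
  then show ?case by simp
next
  case (Suc n)
  show ?case
  proof (cases k)
    case 0
    then show ?thesis by simp
  next
    case k: (Suc k')
    have n: "n = k' + d" using Suc.hyps(2) k by simp
    have 1: "qbin q n k' * qfact q k' * qfact q d = qfact q n"
      using Suc.hyps(1)[of k' d] n by simp
    have 2: "qbin q n (Suc k') * qfact q (Suc k') * qfact q d = (1 - q ^ d) * qfact q n"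
    \<comment> \<open>For \<open>d = 0\<close> both sides vanish: the binomial is out of range and
      \<open>1 - q ^ 0 = 0\<close>.\<close>
    proof (cases d)
      case 0
      then show ?thesis using n by (simp add: qbin_eq_0)
    next
      case d: (Suc d')
      have "qbin q n (Suc k') * qfact q (Suc k') * qfact q d' = qfact q n"
        using Suc.hyps(1)[of "Suc k'" d'] n d by simp
      then show ?thesis unfolding d qfact_Suc[of q d'] by (metis mult.assoc mult.commute)
    qed
    have "qbin q (k + d) k * qfact q k * qfact q d
        = qbin q n (Suc k') * qfact q (Suc k') * qfact q d
          + q ^ d * (1 - q ^ Suc k') * (qbin q n k' * qfact q k' * qfact q d)"
      using n k by (simp add: algebra_simps)
    also have "\<dots> = (1 - q ^ d) * qfact q n + q ^ d * (1 - q ^ Suc k') * qfact q n"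
      by (simp only: 1 2)
    also have "\<dots> = qfact q (k + d)"
      using n k by (simp add: algebra_simps power_add)
    finally show ?thesis .
  qed
qed

text \<open>These assumptions make every \<open>qfact q n\<close> invertible. The identities are
  needed for \<open>q\<close>, \<open>inverse q\<close> and \<open>q ^ 2\<close> alike, hence a
  locale.\<close>

locale q_parameter =
  fixes q :: "'a::field"
  assumes q_nonzero: "q \<noteq> 0" and not_root_of_unity: "i > 0 \<Longrightarrow> q ^ i \<noteq> 1"
begin

lemma qfact_nonzero: "qfact q n \<noteq> 0"
  using not_root_of_unity[of "Suc _"] by (auto simp: qfact_def eq_commute[of 1])

lemma qbin_add: "qbin q (k + d) k = qfact q (k + d) / (qfact q k * qfact q d)"
  using qbin_qfact_add[of q k d] qfact_nonzero by (simp add: field_simps)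

lemma qbin_shift_lower:
  "(1 - q ^ Suc k) * qbin q (Suc (k + d)) (Suc k) = (1 - q ^ Suc d) * qbin q (Suc (k + d)) k"
proof -
  have 1: "qbin q (Suc (k + d)) (Suc k) = qfact q (Suc (k + d)) / (qfact q (Suc k) * qfact q d)"
    using qbin_add[of "Suc k" d] by simp
  have 2: "qbin q (Suc (k + d)) k = qfact q (Suc (k + d)) / (qfact q k * qfact q (Suc d))"
    using qbin_add[of k "Suc d"] by simp
  have nz: "qfact q k \<noteq> 0" "qfact q d \<noteq> 0" "1 - q ^ Suc k \<noteq> 0" "1 - q ^ Suc d \<noteq> 0"
    using qfact_nonzero not_root_of_unity[of "Suc _"] by (auto simp: eq_commute[of 1])
  show ?thesis
    unfolding 1 2 qfact_Suc[of q k] qfact_Suc[of q d] using nz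
    by (simp add: field_simps del: power_Suc)
qed

lemma qbin_shift_upper:
  "(1 - q ^ Suc d) * qbin q (Suc (k + d)) k = (1 - q ^ Suc (k + d)) * qbin q (k + d) k"
proof -
  have 1: "qbin q (k + d) k = qfact q (k + d) / (qfact q k * qfact q d)"
    by (rule qbin_add)
  have 2: "qbin q (Suc (k + d)) k = qfact q (Suc (k + d)) / (qfact q k * qfact q (Suc d))"
    using qbin_add[of k "Suc d"] by simp
  have nz: "qfact q k \<noteq> 0" "qfact q d \<noteq> 0" "1 - q ^ Suc d \<noteq> 0"
    using qfact_nonzero not_root_of_unity[of "Suc _"] by (auto simp: eq_commute[of 1])
  show ?thesis
    unfolding 1 2 qfact_Suc using nz by (simp add: field_simps del: power_Suc)
qed

text \<open>The mirrored Pascal rule. Over a common denominator it reads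
  \<open>1 - q^(n+1) = q^(k+1) (1 - q^(n-k)) + (1 - q^(k+1))\<close>.\<close>

lemma qbin_Suc_Suc':
  "qbin q (Suc n) (Suc k) = q ^ Suc k * qbin q n (Suc k) + qbin q n k"
proof (cases "k < n")
  case True
  then obtain d where d: "n = Suc k + d" by (metis less_iff_Suc_add add_Suc)
  have 1: "qbin q n (Suc k) = qfact q n / (qfact q (Suc k) * qfact q d)"
    using qbin_add[of "Suc k" d] d by simp
  have 2: "qbin q n k = qfact q n / (qfact q k * qfact q (Suc d))"
    using qbin_add[of k "Suc d"] d by simp
  have 3: "qbin q (Suc n) (Suc k) = qfact q (Suc n) / (qfact q (Suc k) * qfact q (Suc d))"
    using qbin_add[of "Suc k" "Suc d"] d by simp
  have nz: "qfact q k \<noteq> 0" "qfact q d \<noteq> 0" "1 - q ^ Suc k \<noteq> 0" "1 - q ^ Suc d \<noteq> 0"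
    using qfact_nonzero not_root_of_unity[of "Suc _"] by (auto simp: eq_commute[of 1])
  have 4: "q ^ Suc n = q ^ Suc k * q ^ Suc d"
    unfolding d by (simp add: power_add)
  show ?thesis
    unfolding 1 2 3 qfact_Suc 4 using nz
    by (simp add: divide_simps del: power_Suc) (simp add: algebra_simps)
next
  case False
  then show ?thesis
    by (cases "n = k") (simp_all add: qbin_eq_0)
qed

text \<open>Both sides are the q-multinomial coefficient with blocks \<open>m\<close>,
  \<open>k - m\<close> and \<open>n - k\<close>.\<close>

lemma qbin_mult_qbin:
  assumes "m \<le> k" "k \<le> n"
  shows "qbin q n m * qbin q (n - m) (k - m) = qbin q n k * qbin q k m"
proof -
  obtain d e where k: "k = m + d" and n: "n = m + d + e"
    using assms by (metis le_iff_add)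
  have "qbin q n m = qfact q n / (qfact q m * qfact q (d + e))"
    using qbin_add[of m "d + e"] n by (simp add: add.assoc)
  moreover have "qbin q n k = qfact q n / (qfact q k * qfact q e)"
    using qbin_add[of k e] n k by simp
  moreover have "qbin q k m = qfact q k / (qfact q m * qfact q d)"
    using qbin_add[of m d] k by simp
  moreover have "qbin q (n - m) (k - m) = qfact q (d + e) / (qfact q d * qfact q e)"
    using qbin_add[of d e] n k by (simp add: add.assoc)
  ultimately show ?thesis using qfact_nonzero by simp
qed

lemma q_parameter_inverse: "q_parameter (inverse q)"
  by unfold_locales (auto simp: q_nonzero not_root_of_unity power_inverse)

text \<open>Inverting \<open>q\<close> exchanges the two Pascal rules up to powers of
  \<open>q\<close>, so the induction compares one rule with the other.\<close>

lemma qbin_inverse: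
  "qbin q (k + d) k = q ^ (k * d) * qbin (inverse q) (k + d) k"
proof (induction "k + d" arbitrary: k d)
  case 0
  then show ?case by simp
next
  case (Suc n)
  show ?case
  proof (cases k)
    case 0
    then show ?thesis by simp
  next
    case k: (Suc k')
    have n: "n = k' + d" using Suc.hyps(2) k by simp
    have 1: "qbin q n k' = q ^ (k' * d) * qbin (inverse q) n k'"
      using Suc.hyps(1)[of k' d] n by simp
    have 2: "q ^ k * qbin q n k = q ^ (k * d) * qbin (inverse q) n k"
    proof (cases d)
      case 0
      then show ?thesis using n k by (simp add: qbin_eq_0)
    next
      case d: (Suc d')
      then have "qbin q n k = q ^ (k * d') * qbin (inverse q) n k"
        using Suc.hyps(1)[of k d'] n k by simp
      then show ?thesis unfolding d by (simp add: power_add)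
    qed
    have 3: "q ^ (k * d) * inverse q ^ d = q ^ (k' * d)"
      unfolding k using q_nonzero by (simp add: power_add field_simps)
    have "qbin q (k + d) k = q ^ k * qbin q n k + qbin q n k'"
      using qbin_Suc_Suc'[of n k'] n k by simp
    also have "\<dots> = q ^ (k * d) * (qbin (inverse q) n k + inverse q ^ d * qbin (inverse q) n k')"
      unfolding 1 2 distrib_left mult.assoc[symmetric] 3 ..
    also have "\<dots> = q ^ (k * d) * qbin (inverse q) (k + d) k"
      using n k by simp
    finally show ?thesis .
  qed
qed

text \<open>The identity with its denominators cleared. After the mirrored Pascal rule the two sums
  merge because \<open>(1 - X Y q^m) + X (1 + Y q^m) = 1 + X\<close>; what remains is the case
  \<open>k\<close> with \<open>X * q\<close> for \<open>X\<close>.\<close>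

lemma q_Chu_Vandermonde:
  "(\<Sum>m\<le>k. qbin q k m * (\<Prod>i<m. X * q ^ i * (1 + Y * q ^ i)) * (\<Prod>i=m..<k. 1 - X * Y * q ^ i))
   = (\<Prod>i<k. 1 + X * q ^ i)"
proof (induction k arbitrary: X)
  case 0
  then show ?case by simp
next
  case (Suc k)
  define u where "u m = (\<Prod>i<m. X * q ^ i * (1 + Y * q ^ i))" for m
  define v where "v m = (\<Prod>i=m..<Suc k. 1 - X * Y * q ^ i)" for m
  have v: "v m = (1 - X * Y * q ^ m) * v (Suc m)" if "m \<le> k" for m
    unfolding v_def using that by (intro prod.atLeast_Suc_lessThan) simp
  have u: "u (Suc m) = u m * (X * q ^ m * (1 + Y * q ^ m))" for m
    by (simp add: u_def)
  \<comment> \<open>With \<open>X * q\<close> for \<open>X\<close>, the two products of the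
    induction hypothesis become \<open>q ^ m * u m\<close> and \<open>v (Suc m)\<close>.\<close>
  have 1: "(\<Prod>i<m. X * q * q ^ i * (1 + Y * q ^ i)) = q ^ m * u m" for m
    by (induction m) (simp_all add: u_def mult_ac)
  have 2: "(\<Prod>i=m..<k. 1 - X * q * Y * q ^ i) = v (Suc m)" for m
    unfolding v_def prod.shift_bounds_Suc_ivl by (simp add: mult_ac)
  have "(\<Sum>m\<le>Suc k. qbin q (Suc k) m * u m * v m)
      = u 0 * v 0 + (\<Sum>m\<le>k. qbin q (Suc k) (Suc m) * u (Suc m) * v (Suc m))"
    by (subst sum.atMost_Suc_shift) simp
  also have "\<dots> = u 0 * v 0 + (\<Sum>m\<le>k. q ^ Suc m * qbin q k (Suc m) * u (Suc m) * v (Suc m))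
       + (\<Sum>m\<le>k. qbin q k m * u (Suc m) * v (Suc m))"
    unfolding qbin_Suc_Suc' by (simp only: sum.distrib distrib_right add.assoc)
  also have "u 0 * v 0 + (\<Sum>m\<le>k. q ^ Suc m * qbin q k (Suc m) * u (Suc m) * v (Suc m))
      = (\<Sum>m\<le>Suc k. q ^ m * qbin q k m * u m * v m)"
    by (subst sum.atMost_Suc_shift) simp
  also have "\<dots> = (\<Sum>m\<le>k. q ^ m * qbin q k m * u m * v m)"
    by (simp add: qbin_eq_0)
  also have "\<dots> + (\<Sum>m\<le>k. qbin q k m * u (Suc m) * v (Suc m))
      = (1 + X) * (\<Sum>m\<le>k. qbin q k m * (q ^ m * u m) * v (Suc m))"
    unfolding sum_distrib_left sum.distrib[symmetric]
    by (intro sum.cong refl) (simp add: u v algebra_simps)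
  also have "\<dots> = (1 + X) * (\<Prod>i<k. 1 + X * q * q ^ i)"
    using Suc.IH[of "X * q"] by (simp only: 1 2)
  also have "\<dots> = (\<Prod>i<Suc k. 1 + X * q ^ i)"
    by (subst prod.lessThan_Suc_shift) (simp add: mult_ac)
  finally show ?case by (simp only: u_def v_def)
qed

text \<open>This is \<open>q\<close> to the power \<open>j (j + 1) / 2\<close>, the weight of the
  staircase \<open>j, ..., 1\<close>.\<close>

definition triangle_pow :: "nat \<Rightarrow> 'a" where
  "triangle_pow j = (\<Prod>i<j. q ^ Suc i)"

lemma triangle_pow_add: "triangle_pow (m + d) = triangle_pow m * triangle_pow d * q ^ (m * d)"
  by (induction d) (simp_all add: triangle_pow_def power_add mult_ac)

section \<open>The generating function of lecture hall partitions\<close>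

text \<open>The closed form for lists with positive entries only. That it counts them is shown by
  \<open>gf_positive_lecture_hall\<close>.\<close>

definition lecture_hall_gf :: "nat \<Rightarrow> nat \<Rightarrow> 'a" where
  "lecture_hall_gf n k =
     triangle_pow k * qbin q n k * (\<Prod>i<k. (1 + q ^ (n - i)) / (1 - q ^ (2 * n - i)))"

text \<open>The exponents \<open>n - i\<close> fall as \<open>i\<close> grows, so this is
  q-Chu-Vandermonde at base \<open>inverse q\<close> with \<open>X = Y = q ^ n\<close>. Reversing
  \<open>qbin q k m\<close> yields the factor \<open>q ^ (m * (k - m))\<close> that joins the two
  triangles into \<open>triangle_pow k\<close>.\<close>

lemma lecture_hall_gf_recurrence:
  assumes "k \<le> n"
  shows "lecture_hall_gf n k =
    (\<Sum>m\<le>k. (\<Prod>i<m. q ^ (n - i)) * lecture_hall_gf n m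
         * (triangle_pow (k - m) * qbin q (n - m) (k - m)))"
proof -
  define X where "X = q ^ n"
  have X: "q ^ (n - i) = X * inverse q ^ i" "q ^ (2 * n - i) = X * X * inverse q ^ i" if "i < k" for i
    using that assms q_nonzero
    by (simp_all add: X_def power_diff power_inverse divide_inverse mult_2 power_add)
  define D where "D m = (\<Prod>i<m. 1 - X * X * inverse q ^ i)" for m
  have Dnz: "D k \<noteq> 0"
    using X(2) not_root_of_unity[of "2 * n - _"] assms
    by (fastforce simp: D_def)
  have D: "D k = D m * (\<Prod>i=m..<k. 1 - X * X * inverse q ^ i)" if "m \<le> k" for m
    using that prod.atLeastLessThan_concat[of 0 m k "\<lambda>i. 1 - X * X * inverse q ^ i"]
    unfolding D_def by (simp add: atLeast0LessThan)
  have summand: "(\<Prod>i<m. q ^ (n - i)) * lecture_hall_gf n m * (triangle_pow (k - m) * qbin q (n - m) (k - m))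
     = triangle_pow k * qbin q n k / D k * (qbin (inverse q) k m
        * (\<Prod>i<m. X * inverse q ^ i * (1 + X * inverse q ^ i)) * (\<Prod>i=m..<k. 1 - X * X * inverse q ^ i))"
    if m: "m \<le> k" for m
  proof -
    obtain d where d: "k = m + d" using m by (metis le_iff_add)
    have 1: "qbin q n m * qbin q (n - m) (k - m) = qbin q n k * (q ^ (m * d) * qbin (inverse q) k m)"
      using qbin_mult_qbin[OF m assms] qbin_inverse[of m d] d by simp
    have "(\<Prod>i<m. q ^ (n - i)) * lecture_hall_gf n m * (triangle_pow (k - m) * qbin q (n - m) (k - m))
       = (triangle_pow m * triangle_pow d) * (qbin q n m * qbin q (n - m) (k - m))
         * (\<Prod>i<m. q ^ (n - i) * ((1 + q ^ (n - i)) / (1 - q ^ (2 * n - i))))"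
      unfolding lecture_hall_gf_def prod.distrib d by (simp add: mult_ac)
    also have "(\<Prod>i<m. q ^ (n - i) * ((1 + q ^ (n - i)) / (1 - q ^ (2 * n - i))))
       = (\<Prod>i<m. X * inverse q ^ i * (1 + X * inverse q ^ i)) / D m"
      unfolding D_def prod_dividef[symmetric] using X m
      by (intro prod.cong) auto
    also have "\<dots> = (\<Prod>i<m. X * inverse q ^ i * (1 + X * inverse q ^ i))
         * (\<Prod>i=m..<k. 1 - X * X * inverse q ^ i) / D k"
      using Dnz unfolding D[OF m] by (simp add: field_simps)
    also have "(triangle_pow m * triangle_pow d) * (qbin q n m * qbin q (n - m) (k - m))
       = triangle_pow k * qbin q n k * qbin (inverse q) k m"
      by (simp only: 1) (simp add: d triangle_pow_add mult_ac)
    finally show ?thesis by (simp add: mult_ac)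
  qed
  have "(\<Sum>m\<le>k. (\<Prod>i<m. q ^ (n - i)) * lecture_hall_gf n m
         * (triangle_pow (k - m) * qbin q (n - m) (k - m)))
     = triangle_pow k * qbin q n k / D k * (\<Prod>i<k. 1 + X * inverse q ^ i)"
    unfolding q_parameter.q_Chu_Vandermonde[OF q_parameter_inverse, of k X X, symmetric] sum_distrib_left
    by (intro sum.cong refl summand) simp
  also have "\<dots> = triangle_pow k * qbin q n k * ((\<Prod>i<k. 1 + X * inverse q ^ i) / D k)"
    by simp
  also have "(\<Prod>i<k. 1 + X * inverse q ^ i) / D k = (\<Prod>i<k. (1 + q ^ (n - i)) / (1 - q ^ (2 * n - i)))"
    unfolding D_def prod_dividef[symmetric] using X by (intro prod.cong) auto
  finally show ?thesis unfolding lecture_hall_gf_def ..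
qed

text \<open>The new factor \<open>1 + q ^ (n - k)\<close> meets \<open>1 - q ^ (n - k)\<close> from
  the ratio of neighbouring Gaussian binomials.\<close>

lemma lecture_hall_gf_Suc:
  assumes "k < n"
  shows "lecture_hall_gf n (Suc k) * ((1 - q ^ Suc k) * (1 - q ^ (2 * n - k)))
       = q ^ Suc k * (1 - q ^ (2 * (n - k))) * lecture_hall_gf n k"
proof -
  obtain d where d: "n = Suc k + d" using assms by (metis less_iff_Suc_add add_Suc)
  have nz: "1 - q ^ (2 * n - k) \<noteq> 0"
    using not_root_of_unity[of "2 * n - k"] assms by simp
  have 3: "n - k = Suc d" "q ^ (2 * Suc d) = q ^ Suc d * q ^ Suc d"
    using d by (simp_all add: mult_2 power_add)
  have 4: "qbin q n (Suc k) * (1 - q ^ Suc k) = (1 - q ^ Suc d) * qbin q n k"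
    using qbin_shift_lower[of k d] d by (simp add: mult.commute)
  define P where "P = (\<Prod>i<k. q ^ Suc i) * (\<Prod>i<k. (1 + q ^ (n - i)) / (1 - q ^ (2 * n - i)))"
  have "lecture_hall_gf n (Suc k) * ((1 - q ^ Suc k) * (1 - q ^ (2 * n - k)))
      = P * q ^ Suc k * (1 + q ^ Suc d) * (qbin q n (Suc k) * (1 - q ^ Suc k))"
    unfolding lecture_hall_gf_def triangle_pow_def prod.lessThan_Suc 3 P_def using nz by simp
  also have "\<dots> = q ^ Suc k * (1 - q ^ Suc d * q ^ Suc d) * (P * qbin q n k)"
    unfolding 4 by (simp add: algebra_simps del: power_Suc)
  also have "P * qbin q n k = lecture_hall_gf n k"
    unfolding lecture_hall_gf_def triangle_pow_def P_def by simp
  finally show ?thesis by (simp only: 3)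
qed


section \<open>Complete homogeneous polynomials in odd powers\<close>

text \<open>
  The complete homogeneous polynomial of degree \<open>t\<close> in the \<open>m\<close> variables \<open>q ^ (2 * a + 1), q ^ (2 * a + 3), \<dots>\<close>.
  The truncation in \<open>m + t - 1\<close> only occurs for \<open>m = t = 0\<close>, where the value is \<open>1\<close> as it should be.
\<close>
definition odd_homogeneous :: "nat \<Rightarrow> nat \<Rightarrow> nat \<Rightarrow> 'a" where
  "odd_homogeneous a m t = q ^ (t * (2 * a + 1)) * qbin (q ^ 2) (m + t - 1) t"

lemma odd_homogeneous_0 [simp]: "odd_homogeneous a m 0 = 1"
  by (simp add: odd_homogeneous_def)

lemma odd_homogeneous_empty [simp]: "odd_homogeneous a 0 (Suc t) = 0"
  by (simp add: odd_homogeneous_def qbin_eq_0)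

text \<open>Monomials without and with the last variable \<open>q ^ (2 * (a + m) + 1)\<close>;
  algebraically, the defining Pascal rule at \<open>q ^ 2\<close>.\<close>

lemma odd_homogeneous_top:
  "odd_homogeneous a (Suc m) (Suc t)
   = odd_homogeneous a m (Suc t) + q ^ (2 * (a + m) + 1) * odd_homogeneous a (Suc m) t"
  by (simp add: odd_homogeneous_def algebra_simps power_add flip: power_mult)

lemma q_parameter_square: "q_parameter (q ^ 2)"
  by unfold_locales (use q_nonzero not_root_of_unity in \<open>auto simp flip: power_mult\<close>)

text \<open>The same split at the first variable, from the mirrored Pascal rule.\<close>

lemma odd_homogeneous_bottom:
  "odd_homogeneous a (Suc m) (Suc t)
   = odd_homogeneous (Suc a) m (Suc t) + q ^ (2 * a + 1) * odd_homogeneous a (Suc m) t"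
proof -
  have "q ^ (Suc t * (2 * a + 1)) * (q ^ 2) ^ Suc t = q ^ (Suc t * (2 * Suc a + 1))"
    unfolding power_mult[symmetric] power_add[symmetric] by (rule arg_cong[where f = "power q"]) simp
  then show ?thesis
    using q_parameter.qbin_Suc_Suc'[OF q_parameter_square, of "m + t" t]
    by (simp add: odd_homogeneous_def distrib_left mult.assoc[symmetric] del: power_Suc)
       (simp add: power_add)
qed

definition odd_homogeneous_sum :: "nat \<Rightarrow> nat \<Rightarrow> nat \<Rightarrow> 'a" where
  "odd_homogeneous_sum a m t = (\<Sum>s\<le>t. odd_homogeneous a m s)"

lemma odd_homogeneous_sum_0 [simp]: "odd_homogeneous_sum a m 0 = 1"
  by (simp add: odd_homogeneous_sum_def)

lemma odd_homogeneous_sum_Suc: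
  "odd_homogeneous_sum a m (Suc t) = odd_homogeneous_sum a m t + odd_homogeneous a m (Suc t)"
  by (simp add: odd_homogeneous_sum_def)

lemma odd_homogeneous_sum_top:
  "odd_homogeneous_sum a (Suc m) (Suc t)
   = odd_homogeneous_sum a m (Suc t) + q ^ (2 * (a + m) + 1) * odd_homogeneous_sum a (Suc m) t"
  unfolding odd_homogeneous_sum_def sum.atMost_Suc_shift[of _ t] odd_homogeneous_top
  by (simp add: sum.distrib sum_distrib_left)

lemma odd_homogeneous_sum_bottom:
  "odd_homogeneous_sum a (Suc m) (Suc t)
   = odd_homogeneous_sum (Suc a) m (Suc t) + q ^ (2 * a + 1) * odd_homogeneous_sum a (Suc m) t"
  unfolding odd_homogeneous_sum_def sum.atMost_Suc_shift[of _ t] odd_homogeneous_bottom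
  by (simp add: sum.distrib sum_distrib_left)

text \<open>One factor for each of the first \<open>a\<close> odd numbers and of the last
  \<open>t\<close> odd numbers below \<open>2 * n\<close>; these will be the unrestricted
  parts.\<close>

definition odd_denominator :: "nat \<Rightarrow> nat \<Rightarrow> nat \<Rightarrow> 'a" where
  "odd_denominator n a t = (\<Prod>i<a. 1 - q ^ (2 * i + 1)) * (\<Prod>i<t. 1 - q ^ (2 * (n - i) - 1))"

lemma odd_denominator_nonzero: "t \<le> n \<Longrightarrow> odd_denominator n a t \<noteq> 0"
  using not_root_of_unity[of "2 * _ + 1"] not_root_of_unity[of "2 * (n - _) - 1"]
  by (fastforce simp: odd_denominator_def)

lemma odd_denominator_Suc:
  "odd_denominator n (Suc a) t = odd_denominator n a t * (1 - q ^ (2 * a + 1))"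
  "odd_denominator n a (Suc t) = odd_denominator n a t * (1 - q ^ (2 * (n - t) - 1))"
  by (simp_all add: odd_denominator_def mult_ac)

text \<open>Clearing the denominator of the odd side leaves a power of \<open>q\<close> times one
  Gaussian binomial at \<open>q ^ 2\<close>. The first-order recurrence leads from the even case to
  the odd case with the same \<open>t\<close>, and from there to the even case with
  \<open>Suc t\<close>.\<close>

lemma lecture_hall_gf_even_odd:
  "(2 * t \<le> n \<longrightarrow> lecture_hall_gf n (2 * t) * odd_denominator n t t
      = q ^ (t * (2 * t + 1)) * qbin (q ^ 2) (n - t) t) \<and>
   (2 * t < n \<longrightarrow> lecture_hall_gf n (Suc (2 * t)) * odd_denominator n (Suc t) t
      = q ^ Suc (2 * t) * q ^ (t * (2 * t + 1)) * qbin (q ^ 2) (n - t - 1) t)"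
proof (induction t)
  have odd: "lecture_hall_gf n (Suc (2 * t)) * odd_denominator n (Suc t) t
      = q ^ Suc (2 * t) * q ^ (t * (2 * t + 1)) * qbin (q ^ 2) (n - t - 1) t"
    if even: "lecture_hall_gf n (2 * t) * odd_denominator n t t
      = q ^ (t * (2 * t + 1)) * qbin (q ^ 2) (n - t) t" and n: "2 * t < n" for t
  proof -
    obtain d where d: "n = Suc (t + (t + d))" using n
      by (metis add.assoc less_iff_Suc_add mult_2)
    \<comment> \<open>This factor is the \<open>1 - q ^ (2 * n - k)\<close> of the recurrence at
      \<open>k = 2 * t\<close> and also occurs in \<open>qbin_shift_upper\<close>. The other factor,
      \<open>1 - q ^ Suc (2 * t)\<close>, enlarges the denominator.\<close>
    define Q where "Q = 1 - q ^ (2 * (n - t))"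
    have Q: "Q \<noteq> 0" using not_root_of_unity[of "2 * (n - t)"] n by (simp add: Q_def)
    have 1: "(1 - q ^ (2 * (n - 2 * t))) * qbin (q ^ 2) (n - t) t = Q * qbin (q ^ 2) (n - t - 1) t"
      using q_parameter.qbin_shift_upper[OF q_parameter_square, of d t] unfolding Q_def power_mult by (simp add: d del: power_Suc)
    have 2: "2 * n - 2 * t = 2 * (n - t)" by simp
    have "Q * (lecture_hall_gf n (Suc (2 * t)) * odd_denominator n (Suc t) t)
       = odd_denominator n t t * (lecture_hall_gf n (Suc (2 * t))
           * ((1 - q ^ Suc (2 * t)) * (1 - q ^ (2 * n - 2 * t))))"
      unfolding odd_denominator_Suc Q_def 2 by simp
    also have "\<dots> = q ^ Suc (2 * t) * (1 - q ^ (2 * (n - 2 * t)))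
          * (lecture_hall_gf n (2 * t) * odd_denominator n t t)"
      unfolding lecture_hall_gf_Suc[OF n] by (simp add: mult_ac)
    also have "\<dots> = q ^ Suc (2 * t) * q ^ (t * (2 * t + 1))
          * ((1 - q ^ (2 * (n - 2 * t))) * qbin (q ^ 2) (n - t) t)"
      unfolding even by (simp add: mult_ac)
    also have "\<dots> = Q * (q ^ Suc (2 * t) * q ^ (t * (2 * t + 1)) * qbin (q ^ 2) (n - t - 1) t)"
      unfolding 1 by (simp add: mult_ac)
    finally show ?thesis using Q by simp
  qed
  {
    case 0
    have "lecture_hall_gf n (2 * 0) * odd_denominator n 0 0
        = q ^ (0 * (2 * 0 + 1)) * qbin (q ^ 2) (n - 0) 0"
      by (simp add: lecture_hall_gf_def triangle_pow_def odd_denominator_def)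
    with odd[of 0] show ?case by blast
  next
    case (Suc t)
    have "lecture_hall_gf n (2 * Suc t) * odd_denominator n (Suc t) (Suc t)
      = q ^ (Suc t * (2 * Suc t + 1)) * qbin (q ^ 2) (n - Suc t) (Suc t)" if n: "2 * Suc t \<le> n"
    proof -
      obtain d where "n = 2 * Suc t + d" using le_Suc_ex[OF n] by blast
      then have d: "n = Suc (Suc (t + (t + d)))" by simp
      \<comment> \<open>Now the roles are swapped: \<open>1 - q ^ Suc k\<close> at
        \<open>k = 2 * t + 1\<close> is absorbed by \<open>qbin_shift_lower\<close>, and
        \<open>1 - q ^ (2 * n - k)\<close> enlarges the denominator.\<close>
      define Q where "Q = 1 - q ^ (2 * Suc t)"
      have Q: "Q \<noteq> 0" using not_root_of_unity[of "2 * Suc t"] by (simp add: Q_def)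
      have 1: "(1 - q ^ (2 * (n - Suc (2 * t)))) * qbin (q ^ 2) (n - t - 1) t
          = Q * qbin (q ^ 2) (n - Suc t) (Suc t)"
        using q_parameter.qbin_shift_lower[OF q_parameter_square, of t d] unfolding Q_def power_mult by (simp add: d del: power_Suc)
      have 2: "2 * n - Suc (2 * t) = 2 * (n - t) - 1" "Suc (Suc (2 * t)) = 2 * Suc t" by simp_all
      have 3: "q ^ (2 * Suc t) * (q ^ Suc (2 * t) * q ^ (t * (2 * t + 1))) = q ^ (Suc t * (2 * Suc t + 1))"
        unfolding power_add[symmetric] by (rule arg_cong[where f = "power q"]) simp
      have 4: "lecture_hall_gf n (2 * Suc t) * (Q * (1 - q ^ (2 * (n - t) - 1)))
         = q ^ (2 * Suc t) * (1 - q ^ (2 * (n - Suc (2 * t)))) * lecture_hall_gf n (Suc (2 * t))"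
        using lecture_hall_gf_Suc[of "Suc (2 * t)" n] n unfolding Q_def 2 by simp
      have "Q * (lecture_hall_gf n (2 * Suc t) * odd_denominator n (Suc t) (Suc t))
         = odd_denominator n (Suc t) t * (lecture_hall_gf n (2 * Suc t) * (Q * (1 - q ^ (2 * (n - t) - 1))))"
        unfolding odd_denominator_Suc(2) by (simp add: mult_ac)
      also have "\<dots> = q ^ (2 * Suc t) * (1 - q ^ (2 * (n - Suc (2 * t))))
            * (lecture_hall_gf n (Suc (2 * t)) * odd_denominator n (Suc t) t)"
        unfolding 4 by (simp add: mult_ac)
      also have "\<dots> = (q ^ (2 * Suc t) * (q ^ Suc (2 * t) * q ^ (t * (2 * t + 1))))
            * ((1 - q ^ (2 * (n - Suc (2 * t)))) * qbin (q ^ 2) (n - t - 1) t)"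
        using Suc.IH n by (simp add: mult_ac)
      also have "\<dots> = Q * (q ^ (Suc t * (2 * Suc t + 1)) * qbin (q ^ 2) (n - Suc t) (Suc t))"
        unfolding 1 3 by (simp add: mult_ac)
      finally show ?thesis using Q by simp
    qed
    with odd[of "Suc t"] show ?case by simp
  }
qed

section \<open>The closed form of the odd side and its increments\<close>

definition odd_gf :: "nat \<Rightarrow> nat \<Rightarrow> 'a" where
  "odd_gf n k = odd_homogeneous_sum ((k + 1) div 2) (n - k) (k div 2)
     / odd_denominator n ((k + 1) div 2) (k div 2)"

text \<open>For even \<open>k\<close> the smallest restricted part becomes unrestricted; for odd
  \<open>k\<close> the largest one does, and the bound on the number of restricted parts grows by
  one. Splitting at that variable cancels all but one homogeneous polynomial.\<close>

lemma odd_gf_Suc: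
  assumes "k < n"
  shows "odd_gf n (Suc k) = odd_gf n k + lecture_hall_gf n (Suc k)"
proof (cases "even k")
  case True
  then obtain t where k: "k = 2 * t" by blast
  obtain m where m: "n - k = Suc m" "n - Suc k = m" using assms by (metis Suc_diff_Suc)
  define z where "z = q ^ (2 * t + 1)"
  define D where "D = odd_denominator n t t"
  have D: "D \<noteq> 0" using odd_denominator_nonzero[of t n t] assms k by (simp add: D_def)
  have z: "1 - z \<noteq> 0" using not_root_of_unity[of "2 * t + 1"] by (simp add: z_def)
  have "odd_homogeneous_sum (Suc t) m t - (1 - z) * odd_homogeneous_sum t (Suc m) t
     = z * odd_homogeneous t (Suc m) t"
  \<comment> \<open>For \<open>t = 0\<close> there is no lower degree to split off; all sums are 1
    and both sides equal \<open>z\<close>.\<close>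
  proof (cases t)
    case (Suc u)
    have "odd_homogeneous_sum t (Suc m) t
        = odd_homogeneous_sum (Suc t) m t + z * odd_homogeneous_sum t (Suc m) u"
      using odd_homogeneous_sum_bottom[of t m u] unfolding Suc[symmetric] z_def[symmetric] .
    moreover have "odd_homogeneous_sum t (Suc m) t
        = odd_homogeneous_sum t (Suc m) u + odd_homogeneous t (Suc m) t"
      using odd_homogeneous_sum_Suc[of t "Suc m" u] unfolding Suc[symmetric] .
    ultimately show ?thesis by (simp add: left_diff_distrib) (metis add_diff_cancel_left' right_diff_distrib)
  qed simp
  also have "\<dots> = lecture_hall_gf n (Suc k) * (D * (1 - z))"
  proof -
    have "Suc m + t - 1 = n - t - 1" using m k by simp
    then have "z * odd_homogeneous t (Suc m) t
        = q ^ Suc (2 * t) * q ^ (t * (2 * t + 1)) * qbin (q ^ 2) (n - t - 1) t"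
      by (simp add: odd_homogeneous_def z_def)
    also have "\<dots> = lecture_hall_gf n (Suc k) * odd_denominator n (Suc t) t"
      using lecture_hall_gf_even_odd[of t n] assms k by simp
    finally show ?thesis by (simp only: odd_denominator_Suc D_def z_def)
  qed
  finally have *: "odd_homogeneous_sum (Suc t) m t
     = (1 - z) * odd_homogeneous_sum t (Suc m) t + lecture_hall_gf n (Suc k) * (D * (1 - z))"
    by (simp add: algebra_simps)
  have "odd_gf n (Suc k) = odd_homogeneous_sum (Suc t) m t / (D * (1 - z))"
    using m k by (simp add: odd_gf_def odd_denominator_Suc(1) D_def z_def)
  also have "\<dots> = odd_homogeneous_sum t (Suc m) t / D + lecture_hall_gf n (Suc k)"
    unfolding * using D z by (simp add: add_divide_distrib)
  also have "odd_homogeneous_sum t (Suc m) t / D = odd_gf n k"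
    using m k by (simp add: odd_gf_def D_def)
  finally show ?thesis .
next
  case False
  then obtain t where k: "k = Suc (2 * t)" by (auto elim: oddE)
  obtain m where m: "n - k = Suc m" "n - Suc k = m" using assms by (metis Suc_diff_Suc)
  define w where "w = q ^ (2 * (n - t) - 1)"
  define D where "D = odd_denominator n (Suc t) t"
  have D: "D \<noteq> 0" using odd_denominator_nonzero[of t n "Suc t"] assms k by (simp add: D_def)
  have w: "1 - w \<noteq> 0" using not_root_of_unity[of "2 * (n - t) - 1"] assms k by (simp add: w_def)
  \<comment> \<open>As \<open>n = 2 * t + 2 + m\<close>, this is the last variable for
    \<open>a = Suc t\<close>.\<close>
  have w': "w = q ^ (2 * (Suc t + m) + 1)"
    unfolding w_def using m k by (intro arg_cong[where f = "power q"]) simp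
  have "odd_homogeneous_sum (Suc t) m (Suc t) - (1 - w) * odd_homogeneous_sum (Suc t) (Suc m) t
     = odd_homogeneous (Suc t) (Suc m) (Suc t)"
    using odd_homogeneous_sum_top[of "Suc t" m t] odd_homogeneous_sum_Suc[of "Suc t" "Suc m" t]
    unfolding w'[symmetric] by (simp add: algebra_simps)
  also have "\<dots> = lecture_hall_gf n (Suc k) * (D * (1 - w))"
  proof -
    have "Suc m + Suc t - 1 = n - Suc t" using m k by simp
    then have "odd_homogeneous (Suc t) (Suc m) (Suc t)
        = q ^ (Suc t * (2 * Suc t + 1)) * qbin (q ^ 2) (n - Suc t) (Suc t)"
      by (simp only: odd_homogeneous_def)
    also have "\<dots> = lecture_hall_gf n (2 * Suc t) * odd_denominator n (Suc t) (Suc t)"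
      using lecture_hall_gf_even_odd[of "Suc t" n] assms k by simp
    finally show ?thesis by (simp add: odd_denominator_Suc(2) D_def w_def k)
  qed
  finally have *: "odd_homogeneous_sum (Suc t) m (Suc t)
     = (1 - w) * odd_homogeneous_sum (Suc t) (Suc m) t + lecture_hall_gf n (Suc k) * (D * (1 - w))"
    by (simp add: algebra_simps)
  have "odd_gf n (Suc k) = odd_homogeneous_sum (Suc t) m (Suc t) / (D * (1 - w))"
    using m k by (simp add: odd_gf_def odd_denominator_Suc(2) D_def w_def)
  also have "\<dots> = odd_homogeneous_sum (Suc t) (Suc m) t / D + lecture_hall_gf n (Suc k)"
    unfolding * using D w by (simp add: add_divide_distrib)
  also have "odd_homogeneous_sum (Suc t) (Suc m) t / D = odd_gf n k"
    using m k by (simp add: odd_gf_def D_def)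
  finally show ?thesis .
qed

lemma odd_gf_eq_sum:
  assumes "k \<le> n"
  shows "odd_gf n k = (\<Sum>j\<le>k. lecture_hall_gf n j)"
  using assms
proof (induction k)
  case 0
  then show ?case by (simp add: odd_gf_def odd_denominator_def lecture_hall_gf_def triangle_pow_def)
next
  case (Suc k)
  then show ?case by (simp add: odd_gf_Suc)
qed

end

section \<open>Generating functions of weighted sets\<close>

interpretation X: q_parameter "fls_X :: rat fls"
proof
  fix i :: nat
  assume "i > 0"
  \<comment> \<open>The constant coefficients are 0 and 1.\<close>
  then have "fls_nth ((fls_X :: rat fls) ^ i) 0 \<noteq> fls_nth 1 0" by simp
  then show "(fls_X :: rat fls) ^ i \<noteq> 1" by metis
qed simp

text \<open>An infinite fibre would have \<open>card\<close> 0, and counting would no longer be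
  additive.\<close>

definition finite_fibres :: "('a \<Rightarrow> nat) \<Rightarrow> 'a set \<Rightarrow> bool" where
  "finite_fibres w A \<longleftrightarrow> (\<forall>N. finite {x \<in> A. w x = N})"

text \<open>Laurent series, since the q-Chu-Vandermonde identity is used with \<open>1 / q\<close> for \<open>q\<close>.\<close>
definition gf :: "('a \<Rightarrow> nat) \<Rightarrow> 'a set \<Rightarrow> rat fls" where
  "gf w A = fps_to_fls (Abs_fps (\<lambda>N. of_nat (card {x \<in> A. w x = N})))"

lemma gf_eq_iff: "gf w A = gf v B \<longleftrightarrow> (\<forall>N. card {x \<in> A. w x = N} = card {x \<in> B. v x = N})"
  by (simp add: gf_def fps_eq_iff)

lemma finite_fibres_subset: "finite_fibres w B \<Longrightarrow> A \<subseteq> B \<Longrightarrow> finite_fibres w A"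
  unfolding finite_fibres_def
proof
  fix N assume "\<forall>N. finite {x \<in> B. w x = N}" "A \<subseteq> B"
  then show "finite {x \<in> A. w x = N}"
    by (intro finite_subset[of "{x \<in> A. w x = N}" "{x \<in> B. w x = N}"]) auto
qed

lemma gf_empty [simp]: "gf w {} = 0"
  by (simp add: gf_def fps_zero_def[symmetric])

lemma gf_singleton [simp]: "gf w {x} = fls_X ^ w x"
proof -
  have "card {y \<in> {x}. w y = N} = (if N = w x then 1 else 0)" for N
    by (cases "w x = N") (auto simp: Collect_conv_if)
  then show ?thesis
    unfolding gf_def by (intro fls_eqI) (auto simp: nat_eq_iff)
qed

text \<open>Each decomposition below enters through this rule, with \<open>c\<close> the weight of
  an inserted part or of the amounts added to a list.\<close>

lemma gf_reindex:
  assumes f: "bij_betw f A B" and w: "\<And>x. x \<in> A \<Longrightarrow> v (f x) = w x + c"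
  shows "gf v B = fls_X ^ c * gf w A"
proof -
  have "card {y \<in> B. v y = N} = (if N < c then 0 else card {x \<in> A. w x = N - c})" for N
  proof (cases "N < c")
    case True
    have "v y \<noteq> N" if y: "y \<in> B" for y
    proof -
      obtain x where "x \<in> A" "y = f x" using y bij_betw_imp_surj_on[OF f] by blast
      then show ?thesis using w True by simp
    qed
    then have "{y \<in> B. v y = N} = {}" by blast
    then show ?thesis using True by (simp only: card.empty if_True)
  next
    case False
    have "f ` {x \<in> A. w x = N - c} = {y \<in> B. v y = N}"
      unfolding bij_betw_imp_surj_on[OF f, symmetric] using w False by auto
    moreover have "inj_on f {x \<in> A. w x = N - c}"
      using f by (auto simp: bij_betw_def inj_on_def)
    ultimately have "card {x \<in> A. w x = N - c} = card {y \<in> B. v y = N}"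
      using card_image by fastforce
    then show ?thesis using False by simp
  qed
  then have "Abs_fps (\<lambda>N. of_nat (card {y \<in> B. v y = N}) :: rat)
      = fps_X ^ c * Abs_fps (\<lambda>N. of_nat (card {x \<in> A. w x = N}))"
    by (simp add: fps_eq_iff fps_X_power_mult_nth)
  then show ?thesis
    unfolding gf_def by (simp only: fls_times_fps_to_fls fps_to_fls_power fps_X_to_fls)
qed

lemma gf_Un:
  assumes "finite_fibres w A" "finite_fibres w B" "A \<inter> B = {}"
  shows "gf w (A \<union> B) = gf w A + gf w B"
proof -
  have "{x \<in> A \<union> B. w x = N} = {x \<in> A. w x = N} \<union> {x \<in> B. w x = N}" for N by blast
  moreover have "{x \<in> A. w x = N} \<inter> {x \<in> B. w x = N} = {}" for N using assms(3) by blast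
  ultimately have "card {x \<in> A \<union> B. w x = N} = card {x \<in> A. w x = N} + card {x \<in> B. w x = N}" for N
    using assms(1,2) by (simp add: finite_fibres_def card_Un_disjoint)
  then show ?thesis
    unfolding gf_def fps_to_fls_plus[symmetric] fps_to_fls_eq_iff by (simp add: fps_eq_iff del: Un_iff)
qed

lemma finite_fibres_Un: "finite_fibres w A \<Longrightarrow> finite_fibres w B \<Longrightarrow> finite_fibres w (A \<union> B)"
  by (simp add: finite_fibres_def conj_disj_distribR Collect_disj_eq)

text \<open>Finiteness is part of the conclusion because the induction must supply it to
  \<open>gf_Un\<close>.\<close>

lemma gf_UN_atMost:
  assumes "\<And>m. m \<le> (k::nat) \<Longrightarrow> finite_fibres w (A m)"
    and "\<And>i j. i < j \<Longrightarrow> j \<le> k \<Longrightarrow> A i \<inter> A j = {}"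
  shows "gf w (\<Union>m\<le>k. A m) = (\<Sum>m\<le>k. gf w (A m)) \<and> finite_fibres w (\<Union>m\<le>k. A m)"
  using assms
proof (induction k)
  case 0
  then show ?case by simp
next
  case (Suc k)
  have IH: "gf w (\<Union>m\<le>k. A m) = (\<Sum>m\<le>k. gf w (A m)) \<and> finite_fibres w (\<Union>m\<le>k. A m)"
  proof (rule Suc.IH)
    show "finite_fibres w (A m)" if "m \<le> k" for m
      using that by (intro Suc.prems(1)) simp
    show "A i \<inter> A j = {}" if "i < j" "j \<le> k" for i j
      using that by (intro Suc.prems(2)) simp_all
  qed
  have "A m \<inter> A (Suc k) = {}" if "m \<le> k" for m
    using that by (intro Suc.prems(2)) simp_all
  then have "(\<Union>m\<le>k. A m) \<inter> A (Suc k) = {}" by blast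
  then show ?case
    using IH Suc.prems(1)[of "Suc k"]
    by (simp add: atMost_Suc Un_commute[of "A (Suc k)"] gf_Un finite_fibres_Un)
qed

text \<open>Sorting pairs by the weight of the first component gives the Cauchy product.\<close>

lemma gf_Times:
  assumes "finite_fibres w A" "finite_fibres v B"
  shows "gf (\<lambda>(x, y). w x + v y) (A \<times> B) = gf w A * gf v B"
proof -
  have "card {p \<in> A \<times> B. (\<lambda>(x, y). w x + v y) p = N}
      = (\<Sum>i=0..N. card {x \<in> A. w x = i} * card {y \<in> B. v y = N - i})" for N
  proof -
    have "{p \<in> A \<times> B. (\<lambda>(x, y). w x + v y) p = N}
        = (\<Union>i\<in>{0..N}. {x \<in> A. w x = i} \<times> {y \<in> B. v y = N - i})"
      by auto
    also have "card \<dots> = (\<Sum>i=0..N. card ({x \<in> A. w x = i} \<times> {y \<in> B. v y = N - i}))"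
      using assms by (intro card_UN_disjoint) (auto simp: finite_fibres_def)
    finally show ?thesis by (simp add: card_cartesian_product)
  qed
  then show ?thesis
    unfolding gf_def fls_times_fps_to_fls[symmetric] by (simp add: fps_eq_iff fps_mult_nth)
qed

section \<open>Partitions into odd parts\<close>

text \<open>Without zeros there are at most \<open>N\<close> parts, each at most
  \<open>N\<close>.\<close>

lemma finite_fibres_multisets: "finite_fibres sum_mset {p. 0 \<notin># (p :: nat multiset)}"
  unfolding finite_fibres_def
proof
  fix N
  have "p \<in> mset ` {xs. set xs \<subseteq> {..N} \<and> length xs \<le> N}"
    if p: "0 \<notin># p" "sum_mset p = N" for p :: "nat multiset"
  proof -
    obtain xs where xs: "p = mset xs" by (metis ex_mset)
    have "length xs \<le> sum_list xs" if "0 \<notin> set xs" for xs :: "nat list"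
      using that by (induction xs) auto
    from this[of xs] have "length xs \<le> N" using p xs by (simp add: sum_mset_sum_list)
    moreover have "set xs \<subseteq> {..N}"
      using member_le_sum_list p(2) xs by (fastforce simp: sum_mset_sum_list)
    ultimately show ?thesis using xs by blast
  qed
  then have "{p \<in> {p. 0 \<notin># p}. sum_mset p = N} \<subseteq> mset ` {xs. set xs \<subseteq> {..N} \<and> length xs \<le> N}"
    by blast
  then show "finite {p \<in> {p. 0 \<notin># p}. sum_mset p = N}"
    by (rule finite_subset) (intro finite_imageI finite_lists_length_le finite_atMost)
qed

section \<open>Multisets with parts from a prescribed set\<close>

definition parts_from :: "nat set \<Rightarrow> nat multiset set" where
  "parts_from S = {p. set_mset p \<subseteq> S}"

lemma finite_fibres_parts_from: "0 \<notin> S \<Longrightarrow> finite_fibres sum_mset (parts_from S)"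
  by (rule finite_fibres_subset[OF finite_fibres_multisets]) (auto simp: parts_from_def)

lemma finite_fibres_parts_from_size:
  "0 \<notin> S \<Longrightarrow> finite_fibres sum_mset {p \<in> parts_from S. P p}"
  by (rule finite_fibres_subset[OF finite_fibres_parts_from]) auto

lemma bij_betw_add_mset: "bij_betw (add_mset z) A {p. z \<in># p \<and> p - {#z#} \<in> A}"
  by (rule bij_betw_byWitness[where f' = "\<lambda>p. p - {#z#}"]) auto

lemma remove_in_parts_from_insert:
  assumes "z \<in># p"
  shows "p - {#z#} \<in> parts_from (insert z S) \<longleftrightarrow> p \<in> parts_from (insert z S)"
proof -
  obtain q where "p = add_mset z q" using assms by (metis multi_member_split)
  then show ?thesis by (auto simp: parts_from_def)
qed

text \<open>A multiset either avoids \<open>z\<close> or arises uniquely by adding one copy of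
  \<open>z\<close>.\<close>

lemma gf_parts_from_insert:
  assumes "z \<notin> S" "0 \<notin> insert z S"
  shows "gf sum_mset (parts_from (insert z S)) * (1 - fls_X ^ z) = gf sum_mset (parts_from S)"
proof -
  let ?B = "{p \<in> parts_from (insert z S). z \<in># p}"
  have "?B = {p. z \<in># p \<and> p - {#z#} \<in> parts_from (insert z S)}"
    using remove_in_parts_from_insert by auto
  then have "bij_betw (add_mset z) (parts_from (insert z S)) ?B"
    by (simp only: bij_betw_add_mset)
  then have 1: "gf sum_mset ?B = fls_X ^ z * gf sum_mset (parts_from (insert z S))"
    by (rule gf_reindex) simp
  have 2: "parts_from (insert z S) = parts_from S \<union> ?B"
    using assms by (auto simp: parts_from_def)
  have "gf sum_mset (parts_from S \<union> ?B) = gf sum_mset (parts_from S) + gf sum_mset ?B"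
  proof (rule gf_Un)
    show "finite_fibres sum_mset (parts_from S)" "finite_fibres sum_mset ?B"
      using assms finite_fibres_parts_from finite_fibres_parts_from_size by simp_all
    show "parts_from S \<inter> ?B = {}" using assms(1) by (auto simp: parts_from_def)
  qed
  then show ?thesis unfolding 1 2[symmetric] by (simp add: algebra_simps)
qed

lemma gf_parts_from:
  assumes "finite S" "0 \<notin> S"
  shows "gf sum_mset (parts_from S) * (\<Prod>s\<in>S. 1 - fls_X ^ s) = 1"
  using assms
proof (induction S)
  case empty
  have "parts_from {} = {{#}}" by (auto simp: parts_from_def)
  then show ?case by simp
next
  case (insert z S)
  then show ?case using gf_parts_from_insert[of z S] by (simp add: mult.assoc[symmetric])
qed

lemma gf_parts_from_size_insert:
  assumes "z \<notin> T" "0 \<notin> insert z T"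
  shows "gf sum_mset {p \<in> parts_from (insert z T). size p = Suc t}
    = gf sum_mset {p \<in> parts_from T. size p = Suc t}
      + fls_X ^ z * gf sum_mset {p \<in> parts_from (insert z T). size p = t}"
proof -
  let ?A = "{p \<in> parts_from T. size p = Suc t}"
  let ?B = "{p \<in> parts_from (insert z T). z \<in># p \<and> size p = Suc t}"
  have size: "size p = Suc t \<longleftrightarrow> size (p - {#z#}) = t" if "z \<in># p" for p
    using size_Suc_Diff1[OF that] by linarith
  have "?B = {p. z \<in># p \<and> p - {#z#} \<in> {p \<in> parts_from (insert z T). size p = t}}"
    using remove_in_parts_from_insert size by auto
  then have "bij_betw (add_mset z) {p \<in> parts_from (insert z T). size p = t} ?B"
    by (simp only: bij_betw_add_mset)
  then have 1: "gf sum_mset ?B = fls_X ^ z * gf sum_mset {p \<in> parts_from (insert z T). size p = t}"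
    by (rule gf_reindex) simp
  have 2: "{p \<in> parts_from (insert z T). size p = Suc t} = ?A \<union> ?B"
    using assms by (auto simp: parts_from_def)
  have "gf sum_mset (?A \<union> ?B) = gf sum_mset ?A + gf sum_mset ?B"
    using assms by (intro gf_Un finite_fibres_parts_from_size) (auto simp: parts_from_def)
  then show ?thesis unfolding 1 2 .
qed

text \<open>Splitting on the largest allowed part gives the recurrence
  \<open>odd_homogeneous_top\<close>. It lowers either \<open>m\<close> or \<open>t\<close>, hence
  the nested induction.\<close>

lemma gf_parts_from_size_odd:
  "gf sum_mset {p \<in> parts_from ((\<lambda>i. 2 * (a + i) + 1) ` {..<m}). size p = t} = X.odd_homogeneous a m t"
proof -
  define T where "T m = (\<lambda>i. 2 * (a + i) + 1) ` {..<m}" for m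
  have T: "T 0 = {}" "T (Suc m) = insert (2 * (a + m) + 1) (T m)" for m
    by (simp_all add: T_def lessThan_Suc)
  have notin: "2 * (a + m) + 1 \<notin> T m" "0 \<notin> T m" for m by (auto simp: T_def)
  have "gf sum_mset {p \<in> parts_from (T m). size p = t} = X.odd_homogeneous a m t"
  proof (induction t arbitrary: m)
    case 0
    have "{p \<in> parts_from S. size p = 0} = {{#}}" for S by (auto simp: parts_from_def)
    then show ?case by simp
  next
    case IH: (Suc t)
    show ?case
    proof (induction m)
      case 0
      have "{p \<in> parts_from {}. size p = Suc t} = {}" by (auto simp: parts_from_def)
      then show ?case by (simp only: T(1) gf_empty X.odd_homogeneous_empty)
    next
      case (Suc m)
      show ?case
        using gf_parts_from_size_insert[OF notin(1)[of m], of t] notin(2)[of "Suc m"]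
        unfolding T(2)[symmetric] Suc.IH IH.IH X.odd_homogeneous_top by blast
    qed
  qed
  then show ?thesis by (simp only: T_def)
qed

lemma gf_parts_from_size_le:
  assumes "0 \<notin> T"
  shows "gf sum_mset {p \<in> parts_from T. size p \<le> t}
    = (\<Sum>s\<le>t. gf sum_mset {p \<in> parts_from T. size p = s})"
proof -
  have "{p \<in> parts_from T. size p \<le> t} = (\<Union>s\<le>t. {p \<in> parts_from T. size p = s})" by auto
  moreover have "gf sum_mset (\<Union>s\<le>t. {p \<in> parts_from T. size p = s})
      = (\<Sum>s\<le>t. gf sum_mset {p \<in> parts_from T. size p = s})"
    by (rule gf_UN_atMost[THEN conjunct1]) (use assms in \<open>auto intro: finite_fibres_parts_from_size\<close>)
  ultimately show ?thesis by simp
qed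

text \<open>Disjointness lets each multiset be separated uniquely into its parts in \<open>T\<close>
  and the others.\<close>

lemma gf_parts_from_restricted:
  assumes "0 \<notin> S" "0 \<notin> T" "S \<inter> T = {}"
  shows "gf sum_mset {p \<in> parts_from (S \<union> T). size {#j \<in># p. j \<in> T#} \<le> t}
    = gf sum_mset (parts_from S) * gf sum_mset {p \<in> parts_from T. size p \<le> t}"
proof -
  let ?A = "parts_from S \<times> {p \<in> parts_from T. size p \<le> t}"
  let ?B = "{p \<in> parts_from (S \<union> T). size {#j \<in># p. j \<in> T#} \<le> t}"
  have sep: "filter_mset (\<lambda>j. j \<in> T) a = {#}" "filter_mset (\<lambda>j. j \<notin> T) a = a"
    if "set_mset a \<subseteq> S" for a
  proof -
    have "x \<notin># a" if "x \<in> T" for x using that \<open>set_mset a \<subseteq> S\<close> assms(3) by blast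
    then show "filter_mset (\<lambda>j. j \<in> T) a = {#}" "filter_mset (\<lambda>j. j \<notin> T) a = a"
      by (auto intro!: multiset_eqI simp: not_in_iff[symmetric])
  qed
  have sep': "filter_mset (\<lambda>j. j \<in> T) b = b" "filter_mset (\<lambda>j. j \<notin> T) b = {#}"
    if "set_mset b \<subseteq> T" for b
    using that by (auto intro!: multiset_eqI simp: not_in_iff[symmetric])
  have "bij_betw (\<lambda>(a, b). a + b) ?A ?B"
    by (rule bij_betw_byWitness[where f' = "\<lambda>p. ({#j \<in># p. j \<notin> T#}, {#j \<in># p. j \<in> T#})"])
       (auto simp: parts_from_def sep sep' add.commute[of "filter_mset (\<lambda>j. j \<notin> T) _"])
  then have "gf sum_mset ?B = fls_X ^ 0 * gf (\<lambda>(x, y). sum_mset x + sum_mset y) ?A"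
    by (rule gf_reindex) auto
  then show ?thesis
    using gf_Times[OF finite_fibres_parts_from[OF assms(1)] finite_fibres_parts_from_size[OF assms(2)]]
    by simp
qed

text \<open>The odd numbers below \<open>2 * n\<close> form three consecutive blocks
  \<open>S1\<close>, \<open>T\<close>, \<open>S2\<close> of sizes \<open>a\<close>,
  \<open>n - k\<close>, \<open>t\<close>; only \<open>T\<close> is restricted.\<close>

lemma gf_odd_partitions:
  assumes "k \<le> n"
  shows "gf sum_mset {p. (\<forall>j \<in># p. odd j \<and> j < 2 * n) \<and>
            size {#j \<in># p. j \<in> restricted_parts n k#} \<le> k div 2} = X.odd_gf n k"
proof -
  define a t where "a = (k + 1) div 2" and "t = k div 2"
  have k: "k = a + t" by (simp add: a_def t_def)
  define T where "T = (\<lambda>i. 2 * (a + i) + 1) ` {..<n - k}"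
  define S1 where "S1 = (\<lambda>i. 2 * i + 1) ` {..<a}"
  define S2 where "S2 = (\<lambda>i. 2 * (n - i) - 1) ` {..<t}"
  have T: "restricted_parts n k = T"
  proof (intro set_eqI iffI)
    fix j assume "j \<in> restricted_parts n k"
    then have "odd j" "2 * a + 1 \<le> j" "j \<le> 2 * (n - t) - 1"
      by (simp_all add: restricted_parts_def a_def t_def)
    then have "j = 2 * (a + (j div 2 - a)) + 1" "j div 2 - a < n - k"
      using k assms by (auto elim!: oddE)
    then show "j \<in> T" unfolding T_def by blast
  next
    fix j assume "j \<in> T"
    then show "j \<in> restricted_parts n k"
      using k assms unfolding T_def restricted_parts_def a_def[symmetric] t_def[symmetric] by auto
  qed
  have odds: "{j. odd j \<and> j < 2 * n} = (S1 \<union> S2) \<union> T"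
  proof (intro set_eqI iffI)
    fix j assume "j \<in> {j. odd j \<and> j < 2 * n}"
    then obtain i where i: "j = 2 * i + 1" "i < n" by (auto elim!: oddE)
    consider "i < a" | "a \<le> i" "i < n - t" | "n - t \<le> i" by linarith
    then show "j \<in> (S1 \<union> S2) \<union> T"
    proof cases
      case 1
      then show ?thesis using i by (auto simp: S1_def)
    next
      case 2
      then have "j = 2 * (a + (i - a)) + 1" "i - a < n - k" using i k by auto
      then show ?thesis unfolding T_def by blast
    next
      case 3
      then have "j = 2 * (n - (n - 1 - i)) - 1" "n - 1 - i < t" using i k assms by auto
      then show ?thesis unfolding S2_def by blast
    qed
  next
    fix j assume "j \<in> (S1 \<union> S2) \<union> T"
    then show "j \<in> {j. odd j \<and> j < 2 * n}"
      using k assms by (auto simp: S1_def S2_def T_def)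
  qed
  have zero: "0 \<notin> S1 \<union> S2" "0 \<notin> T" and disj: "(S1 \<union> S2) \<inter> T = {}" "S1 \<inter> S2 = {}"
    using k assms by (auto simp: S1_def S2_def T_def)
  have "{p. (\<forall>j \<in># p. odd j \<and> j < 2 * n) \<and> size {#j \<in># p. j \<in> restricted_parts n k#} \<le> k div 2}
      = {p \<in> parts_from ((S1 \<union> S2) \<union> T). size {#j \<in># p. j \<in> T#} \<le> t}"
    unfolding parts_from_def odds[symmetric] T t_def by auto
  moreover have "(\<Prod>s\<in>S1 \<union> S2. 1 - fls_X ^ s) = X.odd_denominator n a t"
  proof -
    have "(\<Prod>s\<in>S1 \<union> S2. 1 - (fls_X :: rat fls) ^ s) = (\<Prod>s\<in>S1. 1 - fls_X ^ s) * (\<Prod>s\<in>S2. 1 - fls_X ^ s)"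
      using disj by (intro prod.union_disjoint) (simp_all add: S1_def S2_def)
    also have "(\<Prod>s\<in>S1. 1 - (fls_X :: rat fls) ^ s) = (\<Prod>i<a. 1 - fls_X ^ (2 * i + 1))"
      unfolding S1_def by (subst prod.reindex) (simp_all add: inj_on_def)
    also have "(\<Prod>s\<in>S2. 1 - (fls_X :: rat fls) ^ s) = (\<Prod>i<t. 1 - fls_X ^ (2 * (n - i) - 1))"
    proof -
      have "inj_on (\<lambda>i. 2 * (n - i) - 1) {..<t}" using k assms by (intro inj_onI) auto
      then show ?thesis unfolding S2_def by (subst prod.reindex) simp_all
    qed
    finally show ?thesis by (simp only: X.odd_denominator_def)
  qed
  then have "gf sum_mset (parts_from (S1 \<union> S2)) = 1 / X.odd_denominator n a t"
    using gf_parts_from[of "S1 \<union> S2"] zero X.odd_denominator_nonzero[of t n a] k assms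
    by (simp add: field_simps S1_def S2_def)
  moreover have "gf sum_mset {p \<in> parts_from T. size p \<le> t} = X.odd_homogeneous_sum a (n - k) t"
    unfolding gf_parts_from_size_le[OF zero(2)] X.odd_homogeneous_sum_def
    by (simp only: T_def gf_parts_from_size_odd)
  ultimately show ?thesis
    using gf_parts_from_restricted[OF zero disj(1), of t]
    by (simp add: X.odd_gf_def a_def t_def)
qed

section \<open>Truncated lecture hall partitions\<close>

lemma finite_fibres_lists: "finite_fibres sum_list {xs :: nat list. length xs = k}"
  unfolding finite_fibres_def
proof
  fix N
  have "{xs \<in> {xs :: nat list. length xs = k}. sum_list xs = N} \<subseteq> {xs. set xs \<subseteq> {..N} \<and> length xs = k}"
    by (auto simp: member_le_sum_list)
  then show "finite {xs \<in> {xs. length xs = k}. sum_list xs = N}"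
    by (rule finite_subset) (intro finite_lists_length_eq finite_atMost)
qed

lemma truncated_lecture_hall_iff:
  assumes "k \<le> n"
  shows "xs \<in> truncated_lecture_hall n k \<longleftrightarrow>
    length xs = k \<and> (\<forall>i. Suc i < k \<longrightarrow> xs ! Suc i * (n - i) \<le> xs ! i * (n - Suc i))"
proof -
  have "real (xs ! Suc i) / real (n - Suc i) \<le> real (xs ! i) / real (n - i)
     \<longleftrightarrow> xs ! Suc i * (n - i) \<le> xs ! i * (n - Suc i)" if "Suc i < k" for i
  proof -
    have pos: "0 < real (n - Suc i)" "0 < real (n - i)" using that assms by simp_all
    have "real (xs ! Suc i) / real (n - Suc i) \<le> real (xs ! i) / real (n - i)
       \<longleftrightarrow> real (xs ! Suc i) * real (n - i) \<le> real (xs ! i) * real (n - Suc i)"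
      using pos by (simp add: field_simps del: of_nat_diff)
    then show ?thesis by (metis of_nat_le_iff of_nat_mult)
  qed
  then show ?thesis unfolding truncated_lecture_hall_def by auto
qed

text \<open>The neighbour inequalities are chained as real quotients, where transitivity is
  immediate, and cross-multiplied only at the end.\<close>

lemma truncated_lecture_hall_le:
  assumes "k \<le> n" "xs \<in> truncated_lecture_hall n k" "i \<le> j" "j < k"
  shows "xs ! j * (n - i) \<le> xs ! i * (n - j)"
proof -
  have "real (xs ! j) / real (n - j) \<le> real (xs ! i) / real (n - i)"
    using assms(3,4)
  proof (induction j rule: dec_induct)
    case (step m)
    then have "real (xs ! Suc m) / real (n - Suc m) \<le> real (xs ! m) / real (n - m)"
      using assms(2) by (simp add: truncated_lecture_hall_def)
    with step show ?case by simp
  qed simp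
  moreover have pos: "0 < real (n - j)" "0 < real (n - i)" using assms by simp_all
  ultimately have "real (xs ! j) * real (n - i) \<le> real (xs ! i) * real (n - j)"
    by (simp add: field_simps del: of_nat_diff)
  then show ?thesis by (metis of_nat_le_iff of_nat_mult)
qed

section \<open>Reduction to positive entries\<close>

definition positive_lecture_hall :: "nat \<Rightarrow> nat \<Rightarrow> nat list set" where
  "positive_lecture_hall n k = {xs \<in> truncated_lecture_hall n k. 0 \<notin> set xs}"

lemma finite_fibres_truncated_lecture_hall: "finite_fibres sum_list (truncated_lecture_hall n k)"
  by (rule finite_fibres_subset[OF finite_fibres_lists[of k]]) (auto simp: truncated_lecture_hall_def)

lemma finite_fibres_positive_lecture_hall: "finite_fibres sum_list (positive_lecture_hall n k)"
  by (rule finite_fibres_subset[OF finite_fibres_truncated_lecture_hall]) (auto simp: positive_lecture_hall_def)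

text \<open>The ratios decrease weakly, so a zero anywhere forces the last entry to be zero, and
  that entry can be removed.\<close>

lemma truncated_lecture_hall_Suc:
  assumes "Suc k \<le> n"
  shows "truncated_lecture_hall n (Suc k)
    = positive_lecture_hall n (Suc k) \<union> (\<lambda>xs. xs @ [0]) ` truncated_lecture_hall n k"
proof (intro set_eqI iffI)
  fix xs assume xs: "xs \<in> truncated_lecture_hall n (Suc k)"
  show "xs \<in> positive_lecture_hall n (Suc k) \<union> (\<lambda>xs. xs @ [0]) ` truncated_lecture_hall n k"
  proof (cases "0 \<in> set xs")
    case True
    have len: "length xs = Suc k" using xs by (simp add: truncated_lecture_hall_def)
    obtain i where i: "i \<le> k" "xs ! i = 0" using True len by (metis in_set_conv_nth less_Suc_eq_le)
    have "xs ! k * (n - i) \<le> xs ! i * (n - k)"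
      using truncated_lecture_hall_le[OF assms xs, of i k] i by simp
    then have "xs ! k = 0" using i assms by simp
    then have "xs = butlast xs @ [0]"
      using len by (metis append_butlast_last_id diff_Suc_1 last_conv_nth list.size(3) nat.distinct(1))
    moreover have "butlast xs \<in> truncated_lecture_hall n k"
      using xs len by (auto simp: truncated_lecture_hall_def nth_butlast)
    ultimately show ?thesis by blast
  qed (use xs in \<open>simp add: positive_lecture_hall_def\<close>)
next
  fix xs assume "xs \<in> positive_lecture_hall n (Suc k) \<union> (\<lambda>xs. xs @ [0]) ` truncated_lecture_hall n k"
  then show "xs \<in> truncated_lecture_hall n (Suc k)"
    by (auto simp: positive_lecture_hall_def truncated_lecture_hall_def nth_append less_Suc_eq)
qed

lemma gf_truncated_lecture_hall:
  assumes "k \<le> n"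
  shows "gf sum_list (truncated_lecture_hall n k) = (\<Sum>j\<le>k. gf sum_list (positive_lecture_hall n j))"
  using assms
proof (induction k)
  case 0
  have "truncated_lecture_hall n 0 = positive_lecture_hall n 0"
    by (auto simp: positive_lecture_hall_def truncated_lecture_hall_def)
  then show ?case by simp
next
  case (Suc k)
  let ?Z = "(\<lambda>xs. xs @ [0]) ` truncated_lecture_hall n k"
  have sub: "?Z \<subseteq> truncated_lecture_hall n (Suc k)"
    using truncated_lecture_hall_Suc[OF Suc.prems] by blast
  have "bij_betw (\<lambda>xs. xs @ [0]) (truncated_lecture_hall n k) ?Z"
    by (auto simp: bij_betw_def inj_on_def)
  then have "gf sum_list ?Z = fls_X ^ 0 * gf sum_list (truncated_lecture_hall n k)"
    by (rule gf_reindex) simp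
  moreover have "gf sum_list (truncated_lecture_hall n (Suc k))
      = gf sum_list (positive_lecture_hall n (Suc k)) + gf sum_list ?Z"
    unfolding truncated_lecture_hall_Suc[OF Suc.prems]
    by (intro gf_Un finite_fibres_positive_lecture_hall
          finite_fibres_subset[OF finite_fibres_truncated_lecture_hall sub])
       (auto simp: positive_lecture_hall_def)
  ultimately show ?case using Suc by simp
qed

section \<open>Bounded strictly decreasing lists\<close>

definition strict_lists :: "nat \<Rightarrow> nat \<Rightarrow> nat list set" where
  "strict_lists N j = {zs. length zs = j \<and> sorted_wrt (>) zs \<and> set zs \<subseteq> {0<..N}}"

lemma finite_fibres_strict_lists: "finite_fibres sum_list (strict_lists N j)"
  by (rule finite_fibres_subset[OF finite_fibres_lists[of j]]) (auto simp: strict_lists_def)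

text \<open>Whether the first entry is the maximal value \<open>Suc N\<close> mirrors the defining
  Pascal rule, so the induction follows \<open>qbin\<close>.\<close>

lemma gf_strict_lists:
  "gf sum_list (strict_lists N j) = X.triangle_pow j * qbin fls_X N j"
proof (induction "fls_X :: rat fls" N j rule: qbin.induct)
  case (1 N)
  have "strict_lists N 0 = {[]}" by (auto simp: strict_lists_def)
  then show ?case by (simp add: X.triangle_pow_def)
next
  case (2 j)
  have "strict_lists 0 (Suc j) = {}" by (auto simp: strict_lists_def length_Suc_conv)
  then show ?case by simp
next
  case (3 N j)
  let ?Z = "Cons (Suc N) ` strict_lists N j"
  have 1: "strict_lists (Suc N) (Suc j) = strict_lists N (Suc j) \<union> ?Z"
  proof (intro set_eqI iffI)
    fix zs assume zs: "zs \<in> strict_lists (Suc N) (Suc j)"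
    then obtain y ys where y: "zs = y # ys" by (auto simp: strict_lists_def length_Suc_conv)
    then have ys: "\<forall>x\<in>set ys. 0 < x \<and> x < y" "y \<le> Suc N" using zs by (auto simp: strict_lists_def)
    show "zs \<in> strict_lists N (Suc j) \<union> ?Z"
    proof (cases "y = Suc N")
      case True
      then have "ys \<in> strict_lists N j" using zs y ys by (fastforce simp: strict_lists_def)
      then show ?thesis using y True by blast
    next
      case False
      then have "zs \<in> strict_lists N (Suc j)" using zs y ys by (fastforce simp: strict_lists_def)
      then show ?thesis by blast
    qed
  next
    fix zs assume "zs \<in> strict_lists N (Suc j) \<union> ?Z"
    then show "zs \<in> strict_lists (Suc N) (Suc j)" by (fastforce simp: strict_lists_def)
  qed
  have "bij_betw (Cons (Suc N)) (strict_lists N j) ?Z"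
    by (auto simp: bij_betw_def inj_on_def)
  then have 2: "gf sum_list ?Z = fls_X ^ Suc N * gf sum_list (strict_lists N j)"
    by (rule gf_reindex) simp
  have "gf sum_list (strict_lists (Suc N) (Suc j)) = gf sum_list (strict_lists N (Suc j)) + gf sum_list ?Z"
    unfolding 1
  proof (intro gf_Un finite_fibres_strict_lists)
    show "finite_fibres sum_list ?Z"
      using finite_fibres_subset[OF finite_fibres_strict_lists[of "Suc N" "Suc j"]] 1 by blast
  qed (auto simp: strict_lists_def)
  also have "\<dots> = X.triangle_pow (Suc j) * qbin fls_X N (Suc j)
      + fls_X ^ Suc N * (X.triangle_pow j * qbin fls_X N j)"
    unfolding 2 3 ..
  also have "fls_X ^ Suc N * (X.triangle_pow j * qbin fls_X N j)
      = X.triangle_pow (Suc j) * (fls_X ^ (N - j) * qbin fls_X N j)"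
  \<comment> \<open>For \<open>j > N\<close> the Gaussian binomial vanishes on both sides, so the
    truncated \<open>N - j\<close> does not matter.\<close>
  proof (cases "j \<le> N")
    case True
    then have "(fls_X :: rat fls) ^ Suc N = fls_X ^ Suc j * fls_X ^ (N - j)"
      unfolding power_add[symmetric] by simp
    then show ?thesis by (simp add: X.triangle_pow_def mult_ac del: power_Suc)
  qed (simp add: qbin_eq_0)
  finally show ?case by (simp add: distrib_left)
qed

text \<open>The entries with \<open>\<lceil>\<lambda>\<^sub>i\<^sub>+\<^sub>1 / (n - i)\<rceil> \<ge> 2\<close> form an initial segment; its length is \<open>m\<close>.\<close>
definition ceiling_split :: "nat \<Rightarrow> nat \<Rightarrow> nat \<Rightarrow> nat list set" where
  "ceiling_split n k m = {xs \<in> positive_lecture_hall n k. \<forall>i<k. n - i < xs ! i \<longleftrightarrow> i < m}"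

text \<open>Take \<open>m\<close> as the first index whose ratio is at most 1, or \<open>k\<close>
  if there is none; later ratios are no larger.\<close>

lemma positive_lecture_hall_eq_UN:
  assumes "k \<le> n"
  shows "positive_lecture_hall n k = (\<Union>m\<le>k. ceiling_split n k m)"
proof -
  have "\<exists>m\<le>k. xs \<in> ceiling_split n k m" if xs: "xs \<in> positive_lecture_hall n k" for xs
  proof -
    define m where "m = (LEAST i. i = k \<or> xs ! i \<le> n - i)"
    have m: "m = k \<or> xs ! m \<le> n - m" unfolding m_def by (rule LeastI[of _ k]) simp
    have "m \<le> k" unfolding m_def by (rule Least_le) simp
    moreover have "n - i < xs ! i" if "i < m" for i
      using not_less_Least[of i "\<lambda>i. i = k \<or> xs ! i \<le> n - i"] that unfolding m_def by auto
    moreover have "xs ! i \<le> n - i" if "i < k" "m \<le> i" for i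
    proof -
      have "xs ! i * (n - m) \<le> xs ! m * (n - i)"
        using truncated_lecture_hall_le[OF assms _ that(2,1)] xs by (simp add: positive_lecture_hall_def)
      also have "\<dots> \<le> (n - m) * (n - i)" using m that by simp
      finally show ?thesis using that assms by (simp add: mult.commute)
    qed
    ultimately have "\<forall>i<k. n - i < xs ! i \<longleftrightarrow> i < m" by (meson linorder_not_less)
    then show ?thesis using xs \<open>m \<le> k\<close> unfolding ceiling_split_def by blast
  qed
  then show ?thesis by (auto simp: ceiling_split_def)
qed

text \<open>Adding its denominator to each entry raises every ratio by exactly 1, which preserves
  all lecture hall inequalities.\<close>

definition raise :: "nat \<Rightarrow> nat list \<Rightarrow> nat list" where
  "raise n ys = map (\<lambda>i. ys ! i + (n - i)) [0..<length ys]"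

lemma length_raise [simp]: "length (raise n ys) = length ys"
  and nth_raise [simp]: "i < length ys \<Longrightarrow> raise n ys ! i = ys ! i + (n - i)"
  by (simp_all add: raise_def)

lemma sum_list_raise: "sum_list (raise n ys) = sum_list ys + (\<Sum>i<length ys. n - i)"
  by (simp add: sum_list_sum_nth sum.distrib atLeast0LessThan)

lemma strict_lists_iff:
  "zs \<in> strict_lists N j \<longleftrightarrow>
     length zs = j \<and> (\<forall>i. Suc i < j \<longrightarrow> zs ! Suc i < zs ! i) \<and> (\<forall>i<j. 0 < zs ! i \<and> zs ! i \<le> N)"
proof -
  have "sorted_wrt (>) zs \<longleftrightarrow> (\<forall>i. Suc i < length zs \<longrightarrow> zs ! Suc i < zs ! i)"
    by (subst sorted_wrt_iff_nth_Suc_transp) (auto simp: transp_def)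
  then show ?thesis unfolding strict_lists_def by (auto simp: set_conv_nth)
qed

text \<open>With \<open>N = n - m\<close> this keeps all ratios of an appended tail at most
  1.\<close>

lemma strict_lists_nth_le:
  assumes "zs \<in> strict_lists N j" "i < j"
  shows "zs ! i + i \<le> N"
  using assms(2)
proof (induction i)
  case 0
  then show ?case using assms(1) by (auto simp: strict_lists_iff)
next
  case (Suc i)
  then have "zs ! Suc i < zs ! i" using assms(1) by (simp add: strict_lists_iff)
  with Suc show ?case by simp
qed

lemma positive_lecture_hall_iff:
  assumes "k \<le> n"
  shows "xs \<in> positive_lecture_hall n k \<longleftrightarrow> length xs = k \<and> (\<forall>i<k. 0 < xs ! i) \<and>
    (\<forall>i. Suc i < k \<longrightarrow> xs ! Suc i * (n - i) \<le> xs ! i * (n - Suc i))"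
  unfolding positive_lecture_hall_def using truncated_lecture_hall_iff[OF assms]
  by (auto simp: set_conv_nth)

text \<open>Neighbours inside the raised segment keep their order. At the seam the ratio passes from
  above 1 to at most 1. In the tail a strict decrease suffices, because the ratios there are at most
  1.\<close>

lemma raise_append_in_ceiling_split:
  assumes "m \<le> k" "k \<le> n" and ys: "ys \<in> positive_lecture_hall n m"
    and zs: "zs \<in> strict_lists (n - m) (k - m)"
  shows "raise n ys @ zs \<in> ceiling_split n k m"
proof -
  have ys': "length ys = m" "\<And>i. i < m \<Longrightarrow> 0 < ys ! i"
    "\<And>i. Suc i < m \<Longrightarrow> ys ! Suc i * (n - i) \<le> ys ! i * (n - Suc i)"
    using ys assms positive_lecture_hall_iff[of m n ys] by auto
  have zs': "length zs = k - m" "\<And>i. Suc i < k - m \<Longrightarrow> zs ! Suc i < zs ! i"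
    "\<And>i. i < k - m \<Longrightarrow> 0 < zs ! i" "\<And>i. i < k - m \<Longrightarrow> zs ! i + i \<le> n - m"
    using zs strict_lists_nth_le[OF zs] by (auto simp: strict_lists_iff)
  define xs where "xs = raise n ys @ zs"
  have len: "length xs = k" using assms ys' zs' by (simp add: xs_def)
  have low: "xs ! i = ys ! i + (n - i)" if "i < m" for i
    using that ys' by (simp add: xs_def nth_append)
  have high: "xs ! i = zs ! (i - m)" if "m \<le> i" for i
    using that ys' by (simp add: xs_def nth_append)
  have bound: "0 < xs ! i" "xs ! i \<le> n - i" if "m \<le> i" "i < k" for i
  proof -
    have "i - m < k - m" using that assms by simp
    then show "0 < xs ! i" "xs ! i \<le> n - i"
      using zs'(3)[of "i - m"] zs'(4)[of "i - m"] that(1) unfolding high[OF that(1)] by linarith+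
  qed
  have "xs ! Suc i * (n - i) \<le> xs ! i * (n - Suc i)" if i: "Suc i < k" for i
  proof -
    obtain D where D: "n - i = Suc D" "n - Suc i = D" using i assms
      by (metis Suc_diff_Suc Suc_lessD less_le_trans)
    consider "Suc i < m" | "Suc i = m" | "m \<le> i" by linarith
    then show ?thesis
    proof cases
      case 1
      then show ?thesis using ys'(3)[OF 1] by (simp add: low D algebra_simps)
    next
      case 2
      have "xs ! Suc i * (n - i) \<le> (n - Suc i) * (n - i)" using bound(2)[of "Suc i"] 2 i by simp
      also have "\<dots> \<le> (n - Suc i) * xs ! i"
      proof (rule mult_le_mono2)
        show "n - i \<le> xs ! i" using 2 low[of i] by linarith
      qed
      finally show ?thesis by (simp add: mult.commute)
    next
      \<comment> \<open>With \<open>x' + 1 \<le> x\<close> and \<open>x \<le> D + 1\<close> one gets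
        \<open>x' (D + 1) \<le> x (D + 1) - (D + 1) \<le> x D\<close>.\<close>
      case 3
      have "xs ! Suc i < xs ! i" using zs'(2)[of "i - m"] 3 i by (simp add: high Suc_diff_le)
      moreover have "xs ! i \<le> Suc D" using bound(2)[of i] 3 i D by simp
      moreover have "Suc y * Suc D \<le> x * Suc D" if "y < x" for x y using that by (intro mult_le_mono1) simp
      ultimately have "xs ! Suc i * Suc D + Suc D \<le> xs ! i * Suc D" by fastforce
      then show ?thesis using \<open>xs ! i \<le> Suc D\<close> by (simp add: D)
    qed
  qed
  moreover have "0 < xs ! i" if "i < k" for i
    using that bound low[of i] ys'(2)[of i] by (cases "i < m") auto
  moreover have "n - i < xs ! i \<longleftrightarrow> i < m" if "i < k" for i
    using that bound(2)[of i] low[of i] ys'(2)[of i] by (cases "i < m") auto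
  ultimately show ?thesis
    using len positive_lecture_hall_iff[OF assms(2), of xs] unfolding xs_def[symmetric] ceiling_split_def by auto
qed

text \<open>In the segment every ratio exceeds 1, so subtracting the denominators leaves positive
  entries and lowers all ratios by 1. In the tail the inequalities between positive entries are
  already strict decreases.\<close>

lemma ceiling_split_decompose:
  assumes "m \<le> k" "k \<le> n" and xs: "xs \<in> ceiling_split n k m"
  shows "map (\<lambda>i. xs ! i - (n - i)) [0..<m] \<in> positive_lecture_hall n m"
    and "drop m xs \<in> strict_lists (n - m) (k - m)"
proof -
  have pos: "xs \<in> positive_lecture_hall n k" and seg: "\<And>i. i < k \<Longrightarrow> n - i < xs ! i \<longleftrightarrow> i < m"
    using xs by (simp_all add: ceiling_split_def)
  have xs': "length xs = k" "\<And>i. i < k \<Longrightarrow> 0 < xs ! i"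
    "\<And>i. Suc i < k \<Longrightarrow> xs ! Suc i * (n - i) \<le> xs ! i * (n - Suc i)"
    using pos unfolding positive_lecture_hall_iff[OF assms(2)] by blast+
  have low: "n - i < xs ! i" if "i < m" for i
    using seg[of i] that assms(1) by simp
  have low': "n < xs ! i + i" if "i < m" for i
    using low[OF that] by linarith
  have high: "xs ! i \<le> n - i" if "m \<le> i" "i < k" for i
    using seg[of i] that by simp
  have "(xs ! Suc i - (n - Suc i)) * (n - i) \<le> (xs ! i - (n - i)) * (n - Suc i)" if "Suc i < m" for i
  proof -
    define D where "D = n - Suc i"
    have D: "n - i = Suc D" "n - Suc i = D" using that assms(1,2) by (simp_all add: D_def)
    have "Suc D \<le> xs ! i" "D \<le> xs ! Suc i"
      using low[of i] low[of "Suc i"] that unfolding D by simp_all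
    then obtain a b where ab: "xs ! i = Suc D + a" "xs ! Suc i = D + b"
      using le_Suc_ex by blast
    have "xs ! Suc i * (n - i) \<le> xs ! i * (n - Suc i)"
      using that assms by (intro xs'(3)) simp
    then show ?thesis unfolding D ab by (simp add: algebra_simps)
  qed
  then show "map (\<lambda>i. xs ! i - (n - i)) [0..<m] \<in> positive_lecture_hall n m"
    using assms(1,2) low' by (subst positive_lecture_hall_iff) simp_all
  have "xs ! Suc i < xs ! i" if "m \<le> i" "Suc i < k" for i
  proof -
    define D where "D = n - Suc i"
    have D: "n - i = Suc D" "n - Suc i = D" using that assms(1,2) by (simp_all add: D_def)
    \<comment> \<open>A positive \<open>x\<close> turns \<open>x' (D + 1) \<le> x D\<close> into a
      strict bound by \<open>x (D + 1)\<close>.\<close>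
    have "xs ! Suc i * Suc D < xs ! i * Suc D"
      using xs'(3)[of i] xs'(2)[of i] that D by simp
    then show ?thesis by (metis mult_less_cancel2)
  qed
  moreover have "xs ! (m + i) \<le> n - m" if "i < k - m" for i
    using high[of "m + i"] that by linarith
  ultimately show "drop m xs \<in> strict_lists (n - m) (k - m)"
    using xs'(1,2) assms(1) by (simp add: strict_lists_iff)
qed

lemma bij_betw_ceiling_split:
  assumes "m \<le> k" "k \<le> n"
  shows "bij_betw (\<lambda>(ys, zs). raise n ys @ zs)
    (positive_lecture_hall n m \<times> strict_lists (n - m) (k - m)) (ceiling_split n k m)"
proof (rule bij_betw_byWitness[where f' = "\<lambda>xs. (map (\<lambda>i. xs ! i - (n - i)) [0..<m], drop m xs)"], goal_cases)
  case 1
  have "length ys = m" if "ys \<in> positive_lecture_hall n m" for ys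
    using that by (simp add: positive_lecture_hall_def truncated_lecture_hall_def)
  then show ?case by (auto simp: nth_append intro!: nth_equalityI)
next
  case 2
  have "raise n (map (\<lambda>i. xs ! i - (n - i)) [0..<m]) @ drop m xs = xs" if "xs \<in> ceiling_split n k m" for xs
  proof -
    have xs': "length xs = k" "\<And>i. i < m \<Longrightarrow> n - i < xs ! i"
      using that assms by (auto simp: ceiling_split_def positive_lecture_hall_def truncated_lecture_hall_def)
    have "raise n (map (\<lambda>i. xs ! i - (n - i)) [0..<m]) = take m xs"
    proof (rule nth_equalityI)
      fix i assume "i < length (raise n (map (\<lambda>i. xs ! i - (n - i)) [0..<m]))"
      then have i: "i < m" by simp
      then have "xs ! i - (n - i) + (n - i) = xs ! i" using xs'(2)[of i] by linarith
      with i show "raise n (map (\<lambda>i. xs ! i - (n - i)) [0..<m]) ! i = take m xs ! i" by simp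
    qed (use xs' assms in simp)
    then show ?thesis by simp
  qed
  then show ?case by simp
next
  case 3
  then show ?case using raise_append_in_ceiling_split[OF assms] by auto
next
  case 4
  then show ?case using ceiling_split_decompose[OF assms] by auto
qed

section \<open>The recurrence for positive lecture hall partitions and its solution\<close>

lemma gf_positive_lecture_hall_recurrence:
  assumes "k \<le> n"
  shows "gf sum_list (positive_lecture_hall n k) =
    (\<Sum>m\<le>k. (\<Prod>i<m. fls_X ^ (n - i)) * gf sum_list (positive_lecture_hall n m)
        * (X.triangle_pow (k - m) * qbin fls_X (n - m) (k - m)))"
proof -
  have "gf sum_list (ceiling_split n k m)
      = (\<Prod>i<m. fls_X ^ (n - i)) * gf sum_list (positive_lecture_hall n m)
        * (X.triangle_pow (k - m) * qbin fls_X (n - m) (k - m))" if "m \<le> k" for m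
  proof -
    have "gf sum_list (ceiling_split n k m) = fls_X ^ (\<Sum>i<m. n - i) *
        gf (\<lambda>(ys, zs). sum_list ys + sum_list zs) (positive_lecture_hall n m \<times> strict_lists (n - m) (k - m))"
      by (rule gf_reindex[OF bij_betw_ceiling_split[OF that assms]])
         (auto simp: sum_list_raise positive_lecture_hall_def truncated_lecture_hall_def)
    then show ?thesis
      using gf_Times[OF finite_fibres_positive_lecture_hall finite_fibres_strict_lists]
      by (simp add: gf_strict_lists power_sum mult.assoc)
  qed
  moreover have "gf sum_list (\<Union>m\<le>k. ceiling_split n k m) = (\<Sum>m\<le>k. gf sum_list (ceiling_split n k m))"
  proof (rule gf_UN_atMost[THEN conjunct1])
    show "finite_fibres sum_list (ceiling_split n k m)" for m
      by (rule finite_fibres_subset[OF finite_fibres_positive_lecture_hall]) (auto simp: ceiling_split_def)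
    show "ceiling_split n k i \<inter> ceiling_split n k j = {}" if "i < j" "j \<le> k" for i j
    proof -
      \<comment> \<open>Entry \<open>i\<close> is a valid index, and it exceeds \<open>n - i\<close>
        in the second set but not in the first.\<close>
      have "i < k" using that by simp
      then show ?thesis using that(1) by (auto simp: ceiling_split_def)
    qed
  qed
  ultimately show ?thesis unfolding positive_lecture_hall_eq_UN[OF assms] by simp
qed

text \<open>The closed form satisfies the same recurrence. Its term \<open>m = k\<close> contains
  the unknown itself with a coefficient other than 1, so the smaller cases determine the
  solution.\<close>

lemma gf_positive_lecture_hall:
  assumes "k \<le> n"
  shows "gf sum_list (positive_lecture_hall n k) = X.lecture_hall_gf n k"
  using assms
proof (induction k rule: less_induct)
  case (less k)
  show ?case
  proof (cases k)
    case 0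
    have "positive_lecture_hall n 0 = {[]}"
      by (auto simp: positive_lecture_hall_def truncated_lecture_hall_def)
    then show ?thesis using 0 by (simp add: X.lecture_hall_gf_def X.triangle_pow_def)
  next
    case (Suc k')
    define c where "c m = (\<Prod>i<m. (fls_X :: rat fls) ^ (n - i))" for m
    define E where "E m = X.triangle_pow (k - m) * qbin fls_X (n - m) (k - m)" for m
    define P where "P m = gf sum_list (positive_lecture_hall n m)" for m
    \<comment> \<open>The exponent \<open>n + ... + (n - k + 1)\<close> is positive because
      \<open>1 \<le> k \<le> n\<close>.\<close>
    have "c k \<noteq> 1"
      unfolding c_def power_sum[symmetric] using Suc less.prems
      by (intro X.not_root_of_unity) (auto simp: sum.lessThan_Suc_shift simp del: sum.lessThan_Suc)
    moreover have "E k = 1" by (simp add: E_def X.triangle_pow_def)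
    moreover have "P k = (\<Sum>m\<le>k. c m * P m * E m)"
      using gf_positive_lecture_hall_recurrence[OF less.prems] by (simp only: P_def c_def E_def)
    moreover have "X.lecture_hall_gf n k = (\<Sum>m\<le>k. c m * X.lecture_hall_gf n m * E m)"
      using X.lecture_hall_gf_recurrence[OF less.prems] by (simp only: c_def E_def)
    moreover have "(\<Sum>m<k. c m * P m * E m) = (\<Sum>m<k. c m * X.lecture_hall_gf n m * E m)"
      using less by (intro sum.cong) (simp_all add: P_def)
    ultimately have "P k - c k * P k = X.lecture_hall_gf n k - c k * X.lecture_hall_gf n k" "c k \<noteq> 1"
      by (simp_all add: lessThan_Suc_atMost[symmetric]) (metis add_diff_cancel_right')
    then have "(1 - c k) * (P k - X.lecture_hall_gf n k) = 0" "1 - c k \<noteq> 0"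
      by (simp_all add: algebra_simps)
    then show ?thesis by (simp add: P_def)
  qed
qed

theorem theorem5:
  fixes n k N :: nat
  assumes "k \<le> n"
  shows "card {xs \<in> truncated_lecture_hall n k. sum_list xs = N} =
         card {p \<in> partitions_of N.
                 (\<forall>j \<in># p. odd j \<and> j < 2 * n) \<and>
                 size {# j \<in># p. j \<in> restricted_parts n k #} \<le> k div 2}"
proof -
  let ?P = "{p. (\<forall>j \<in># p. odd j \<and> j < 2 * n) \<and>
                 size {# j \<in># p. j \<in> restricted_parts n k #} \<le> k div 2}"
  have "gf sum_list (truncated_lecture_hall n k) = (\<Sum>j\<le>k. X.lecture_hall_gf n j)"
    unfolding gf_truncated_lecture_hall[OF assms]
    using assms by (intro sum.cong refl gf_positive_lecture_hall) simp
  also have "\<dots> = gf sum_mset ?P"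
    unfolding gf_odd_partitions[OF assms] X.odd_gf_eq_sum[OF assms] ..
  finally have "card {xs \<in> truncated_lecture_hall n k. sum_list xs = N} = card {p \<in> ?P. sum_mset p = N}"
    unfolding gf_eq_iff by blast
  \<comment> \<open>Odd parts are nonzero, as \<open>partitions_of\<close> demands.\<close>
  also have "{p \<in> ?P. sum_mset p = N} = {p \<in> partitions_of N.
                 (\<forall>j \<in># p. odd j \<and> j < 2 * n) \<and>
                 size {# j \<in># p. j \<in> restricted_parts n k #} \<le> k div 2}"
    by (auto simp: partitions_of_def)
  finally show ?thesis .
qed

end
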